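(* Let $\mathcal{P}=\{p_1,\dots,p_N\}$ be a finite set of pairwise disjoint polygons in $\mathbb{R}^2$ whose Lebesgue measures sum to $1$, let $\omega$ be a primitive substitution on $\mathcal{P}$ with scaling factor $\lambda>1$, and let $X=\bigcup_{i=1}^N p_i\subset\mathbb{R}^2$. For each $k$ let $\mathcal{T}_k$ be the set of tiles obtained by dividing the polygons of $\mathcal{P}$ $k$ times according to $\omega$ (rescaled by $\lambda^{-k}$), and define the Borel probability measures on $X$ $$\xi_k=\frac{1}{|\mathcal{T}_k|}\sum_{t\in\mathcal{T}_k}\delta_{\mathbf{x}(t)},\qquad \rho_k=\frac{1}{\sum_{t\in\mathcal{T}_k}|\mathbf{v}(t)|}\sum_{t\in\mathcal{T}_k}\ \sum_{x\in\mathbf{v}(t)}\delta_x,\qquad \sigma_k=\frac{1}{|\mathbf{v}(\mathcal{T}_k)|}\sum_{x\in\mathbf{v}(\mathcal{T}_k)}\delta_x ,$$ where $\mathbf{x}(t)$ is the puncture of $t$, $\mathbf{v}(t)$ is the set of vertices of $t$, and $\mathbf{v}(\mathcal{T}_k)=\bigcup_{t\in\mathcal{T}_k}\mathbf{v}(t)$. Then each of the sequences $\{\xi_k\}$, $\{\rho_k\}$ and $\{\sigma_k\}$ converges weak-$*$ to Lebesgue measure $m$ on $X$; that is, $\int_X f\,d\xi_k\to\int_X f\,dm$ for every continuous $f:X\to\mathbb{R}$, and likewise for $\rho_k$ and $\sigma_k$.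
   Context: A polygon is a compact region of $\mathbb{R}^2$ with nonempty interior bounded by a simple closed polygonal curve. The polygons $p_1,\dots,p_N$ (the prototiles) may carry labels so that they are regarded as distinct types. For each prototile $p_i$ a point $\mathbf{x}(p_i)$ in its interior is fixed once and for all (its puncture), and $\mathbf{v}(p_i)$ denotes its finite set of vertices. A substitution $\omega$ on $\mathcal{P}$ with scaling factor $\lambda>1$ assigns to each prototile $p_j$ a finite set $\omega(p_j)$ of tiles, each being a copy $h(p_i)$ of some prototile $p_i$ under a specified isometry $h$ of the plane (type $i$ and isometry $h$ are part of the data), such that the tiles of $\omega(p_j)$ have pairwise disjoint interiors and their union is $\lambda p_j=\{\lambda x: x\in p_j\}$. Iteration, written after rescaling: let $\mathcal{T}_0=\{p_1,\dots,p_N\}$, where $p_i$ is viewed as the tile $g(p_i)$ of type $i$ with $g=\mathrm{id}$. If $t=g(p_j)\in\mathcal{T}_k$ is a tile of type $j$ with associated similarity $g$ (of ratio $\lambda^{-k}$), then $t$ is divided into the tiles $g(\lambda^{-1}h(p_i))$, one for each $h(p_i)\in\omega(p_j)$; this tile has type $i$ and associated similarity $x\mapsto g(\lambda^{-1}h(x))$. $\mathcal{T}_{k+1}$ is the set of all tiles so obtained from all $t\in\mathcal{T}_k$. (Thus $\mathcal{T}_k=\bigcup_j\lambda^{-k}\omega^k(p_j)$.) The tiles of $\mathcal{T}_k$ have pairwise disjoint interiors and union $X$. For a tile $t=g(p_i)\in\mathcal{T}_k$ of type $i$, its puncture is $\mathbf{x}(t)=g(\mathbf{x}(p_i))$ and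 its vertex set is $\mathbf{v}(t)=g(\mathbf{v}(p_i))$. $\omega$ is primitive if there is $M\in\mathbb{N}$ such that for all $p,q\in\mathcal{P}$ the patch $\omega^M(p)$ contains a copy of $q$; equivalently, the $N\times N$ matrix $A$ whose $(i,j)$ entry is the number of tiles of type $i$ in $\omega(p_j)$ is such that $A^M$ has all entries strictly positive. $\delta_x$ is the unit point mass at $x$. *)

theory Defs
  imports "HOL-Probability.Probability"
begin

fun polygonal_path :: "'a::real_normed_vector list \<Rightarrow> real \<Rightarrow> 'a" where
  "polygonal_path [] = linepath 0 0"
| "polygonal_path [a] = linepath a a"
| "polygonal_path [a, b] = linepath a b"
| "polygonal_path (a # b # c # vs) = linepath a b +++ polygonal_path (b # c # vs)"

text \<open>
  \<open>polygon_with_vertices P V\<close>: \<open>P\<close> is a polygon and \<open>V\<close> is its set of vertices, that is,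
  the set of vertices of the simple closed polygonal curve that bounds \<open>P\<close>. Consecutive edges
  of the curve may be collinear, so that straight angles are permitted at vertices.
\<close>

definition polygon_with_vertices :: "(real^2) set \<Rightarrow> (real^2) set \<Rightarrow> bool" where
  "polygon_with_vertices P V \<longleftrightarrow>
     compact P \<and> interior P \<noteq> {} \<and>
     (\<exists>vs. 3 \<le> length vs \<and> set vs = V \<and>
        simple_path (polygonal_path (vs @ [hd vs])) \<and>
        frontier P = path_image (polygonal_path (vs @ [hd vs])))"

text \<open>
  A tile is a pair of its type and the map carrying the prototile of that type onto it. Prototiles
  are indexed by a finite type \<open>'n\<close>; \<open>p i\<close> is the prototile of type \<open>i\<close>.
\<close>

type_synonym 'n tile = "'n \<times> (real^2 \<Rightarrow> real^2)"

definition tile_region :: "('n \<Rightarrow> (real^2) set) \<Rightarrow> 'n tile \<Rightarrow> (real^2) set" where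
  "tile_region p t = snd t ` p (fst t)"

definition tile_puncture :: "('n \<Rightarrow> real^2) \<Rightarrow> 'n tile \<Rightarrow> real^2" where
  "tile_puncture x t = snd t (x (fst t))"

definition tile_vertices :: "('n \<Rightarrow> (real^2) set) \<Rightarrow> 'n tile \<Rightarrow> (real^2) set" where
  "tile_vertices v t = snd t ` v (fst t)"

definition is_substitution ::
    "('n \<Rightarrow> (real^2) set) \<Rightarrow> real \<Rightarrow> ('n \<Rightarrow> 'n tile set) \<Rightarrow> bool" where
  "is_substitution p lam \<omega> \<longleftrightarrow>
     lam > 1 \<and>
     (\<forall>j. finite (\<omega> j) \<and>
          (\<forall>(i, h) \<in> \<omega> j. \<forall>a b. dist (h a) (h b) = dist a b) \<and>
          pairwise (\<lambda>s t. interior (tile_region p s) \<inter> interior (tile_region p t) = {}) (\<omega> j) \<and>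
          (\<Union>t\<in>\<omega> j. tile_region p t) = (\<lambda>a. lam *\<^sub>R a) ` p j)"

definition divide_tiles ::
    "real \<Rightarrow> ('n \<Rightarrow> 'n tile set) \<Rightarrow> 'n tile set \<Rightarrow> 'n tile set" where
  "divide_tiles lam \<omega> T = {(i, \<lambda>a. g (inverse lam *\<^sub>R h a)) | i h j g. (j, g) \<in> T \<and> (i, h) \<in> \<omega> j}"

text \<open>The rescaled patch \<open>lam\<^sup>-\<^sup>k \<omega>\<^sup>k(p j)\<close>, obtained by dividing the prototile \<open>p j\<close> \<open>k\<close> times.\<close>

definition rescaled_patch :: "real \<Rightarrow> ('n \<Rightarrow> 'n tile set) \<Rightarrow> nat \<Rightarrow> 'n \<Rightarrow> 'n tile set" where
  "rescaled_patch lam \<omega> k j = (divide_tiles lam \<omega> ^^ k) {(j, id)}"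

definition tiles :: "real \<Rightarrow> ('n \<Rightarrow> 'n tile set) \<Rightarrow> nat \<Rightarrow> 'n tile set" where
  "tiles lam \<omega> k = (divide_tiles lam \<omega> ^^ k) (range (\<lambda>j. (j, id)))"

text \<open>Rescaling does not change the types of tiles, so copies can be found in the rescaled patch.\<close>

definition primitive_substitution :: "real \<Rightarrow> ('n \<Rightarrow> 'n tile set) \<Rightarrow> bool" where
  "primitive_substitution lam \<omega> \<longleftrightarrow> (\<exists>M. \<forall>i j. \<exists>g. (i, g) \<in> rescaled_patch lam \<omega> M j)"

definition puncture_measure ::
    "(real^2) set \<Rightarrow> ('n \<Rightarrow> real^2) \<Rightarrow> 'n tile set \<Rightarrow> (real^2) measure" where
  "puncture_measure X x T =
     measure_of X (sets (restrict_space borel X))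
       (\<lambda>B. (\<Sum>t\<in>T. emeasure (return (restrict_space borel X) (tile_puncture x t)) B)
            / of_nat (card T))"

definition vertex_multi_measure ::
    "(real^2) set \<Rightarrow> ('n \<Rightarrow> (real^2) set) \<Rightarrow> 'n tile set \<Rightarrow> (real^2) measure" where
  "vertex_multi_measure X v T =
     measure_of X (sets (restrict_space borel X))
       (\<lambda>B. (\<Sum>t\<in>T. \<Sum>a\<in>tile_vertices v t. emeasure (return (restrict_space borel X) a) B)
            / of_nat (\<Sum>t\<in>T. card (tile_vertices v t)))"

definition vertex_measure ::
    "(real^2) set \<Rightarrow> ('n \<Rightarrow> (real^2) set) \<Rightarrow> 'n tile set \<Rightarrow> (real^2) measure" where
  "vertex_measure X v T =
     measure_of X (sets (restrict_space borel X))
       (\<lambda>B. (\<Sum>a\<in>(\<Union>t\<in>T. tile_vertices v t). emeasure (return (restrict_space borel X) a) B)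
            / of_nat (card (\<Union>t\<in>T. tile_vertices v t)))"

definition weak_star_conv ::
    "'a::topological_space set \<Rightarrow> (nat \<Rightarrow> 'a measure) \<Rightarrow> 'a measure \<Rightarrow> bool" where
  "weak_star_conv X \<mu> \<nu> \<longleftrightarrow>
     (\<forall>f :: 'a \<Rightarrow> real. continuous_on X f \<longrightarrow>
        (\<lambda>k. integral\<^sup>L (\<mu> k) f) \<longlonglongrightarrow> integral\<^sup>L \<nu> f)"

end

theory Submission
  imports Defs
begin

text \<open>
  Let \<open>\<Phi>\<^sub>k(j)\<close> count the marked points (punctures, or vertices with or without multiplicity) of the \<open>k\<close>
  times divided prototile \<open>p\<^sub>j\<close>, and let \<open>w\<^sub>k(j) = \<lambda>\<^sup>-\<^sup>2\<^sup>k \<Phi>\<^sub>k(j) / m(p\<^sub>j)\<close>. Since tile areas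
  add up, \<open>w\<^sub>k\<^sub>+\<^sub>n(j)\<close> is, up to \<open>o(1)\<close>, a weighted average of the \<open>w\<^sub>k(i)\<close>, and for suitable \<open>n\<close>
  primitivity bounds the weights away from 0. Averaging then contracts the oscillation of \<open>w\<^sub>k\<close> over the
  types, so \<open>w\<^sub>k(i) - w\<^sub>k(j) \<longrightarrow> 0\<close>: asymptotically each tile receives marked points in proportion to its
  area. A continuous function is nearly constant on the tiles of a fine enough level, which gives
  weak convergence. No convergence of \<open>w\<^sub>k\<close> itself, hence no Perron--Frobenius theory, is used.

  For distinct vertices the average is only approximate, because vertices on common boundaries of
  tiles are counted several times. They number \<open>o(\<lambda>\<^sup>2\<^sup>k)\<close>: the small tiles meeting the boundary of a tile
  lie in a shrinking neighbourhood of that boundary, which is a null set.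
\<close>

section \<open>Similarities\<close>

definition similarity :: "real \<Rightarrow> ('a::metric_space \<Rightarrow> 'b::metric_space) \<Rightarrow> bool" where
  "similarity r g \<longleftrightarrow> r > 0 \<and> (\<forall>a b. dist (g a) (g b) = r * dist a b)"

lemma similarity_dist: "similarity r g \<Longrightarrow> dist (g a) (g b) = r * dist a b"
  by (simp add: similarity_def)

lemma similarity_pos: "similarity r g \<Longrightarrow> 0 < r"
  by (simp add: similarity_def)

lemma similarity_id: "similarity 1 id"
  by (simp add: similarity_def)

lemma similarity_comp: "similarity r g \<Longrightarrow> similarity s h \<Longrightarrow> similarity (r * s) (g \<circ> h)"
  by (simp add: similarity_def)

lemma similarity_inj: "similarity r g \<Longrightarrow> inj g"
  unfolding similarity_def inj_def
  by (metis dist_eq_0_iff less_irrefl mult_eq_0_iff)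

lemma similarity_continuous_on: "similarity r g \<Longrightarrow> continuous_on S g"
  unfolding similarity_def
  by (intro lipschitz_on_continuous_on[of r] lipschitz_onI) auto

text \<open>Invariance of domain applies, since a similarity is continuous and injective.\<close>

lemma similarity_open_image:
  fixes g :: "'a::euclidean_space \<Rightarrow> 'a"
  assumes "similarity r g" "open S" shows "open (g ` S)"
  using assms by (meson inj_on_subset invariance_of_domain similarity_continuous_on similarity_inj subset_UNIV)

text \<open>Openness of \<open>g\<close> gives one inclusion. For the other, the preimage of the
  interior of the image is open by continuity and lies in \<open>S\<close> by injectivity.\<close>

lemma similarity_interior:
  fixes g :: "'a::euclidean_space \<Rightarrow> 'a"
  assumes g: "similarity r g" shows "interior (g ` S) = g ` interior S"
proof
  show "g ` interior S \<subseteq> interior (g ` S)"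
    by (intro interior_maximal image_mono interior_subset similarity_open_image[OF g] open_interior)
  have "open (g -` interior (g ` S))"
    by (simp add: continuous_on_open_vimage[of UNIV, simplified, THEN iffD1, rule_format]
        similarity_continuous_on[OF g])
  moreover have "g -` interior (g ` S) \<subseteq> S"
    using interior_subset similarity_inj[OF g] by (fastforce dest: injD)
  ultimately show "interior (g ` S) \<subseteq> g ` interior S"
    using interior_subset[of "g ` S"] interior_maximal[of "g -` interior (g ` S)" S] by blast
qed

lemma similarity_frontier:
  fixes g :: "'a::euclidean_space \<Rightarrow> 'a"
  assumes g: "similarity r g" and S: "compact S" shows "frontier (g ` S) = g ` frontier S"
proof -
  have "closed (g ` S)" "closed S"
    using S compact_continuous_image[OF similarity_continuous_on[OF g] S] by (auto simp: compact_imp_closed)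
  then show ?thesis
    by (simp add: frontier_def similarity_interior[OF g] image_set_diff[OF similarity_inj[OF g]])
qed

text \<open>Subtracting \<open>g 0\<close> and dividing by \<open>r\<close> leaves an isometry that
  fixes the origin, hence an orthogonal map. Areas of images can then be computed by linear
  algebra.\<close>

lemma similarity_eq:
  fixes g :: "'a::euclidean_space \<Rightarrow> 'a"
  assumes g: "similarity r g"
  obtains T where "orthogonal_transformation T" "g = (\<lambda>a. g 0 + r *\<^sub>R T a)"
proof
  define T where "T = (\<lambda>a. inverse r *\<^sub>R (g a - g 0))"
  show "orthogonal_transformation T"
    unfolding orthogonal_transformation_isometry
    using similarity_pos[OF g] similarity_dist[OF g]
    by (auto simp: T_def dist_norm simp flip: scaleR_diff_right)
  show "g = (\<lambda>a. g 0 + r *\<^sub>R T a)"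
    using similarity_pos[OF g] by (auto simp: T_def)
qed

text \<open>Translations and orthogonal maps preserve area; the factor \<open>r\<^sup>2\<close> is
  the determinant of scaling by \<open>r\<close> in the plane.\<close>

lemma
  fixes g :: "real^2 \<Rightarrow> real^2"
  assumes g: "similarity r g" and S: "S \<in> lmeasurable"
  shows similarity_lmeasurable: "g ` S \<in> lmeasurable"
    and similarity_measure: "measure lebesgue (g ` S) = r\<^sup>2 * measure lebesgue S"
proof -
  obtain T where T: "orthogonal_transformation T" and eq: "g = (\<lambda>a. g 0 + r *\<^sub>R T a)"
    using similarity_eq[OF g] .
  have im: "g ` S = (+) (g 0) ` ((*\<^sub>R) r ` (T ` S))"
    by (subst eq) (auto simp: image_image)
  have 1: "T ` S \<in> lmeasurable" "measure lebesgue (T ` S) = measure lebesgue S"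
    using measurable_orthogonal_image[OF T S] measure_orthogonal_image[OF T S] by auto
  have 2: "linear ((*\<^sub>R) r :: real^2 \<Rightarrow> _)"
    by (simp add: linear_scale_self)
  show "g ` S \<in> lmeasurable"
    unfolding im by (intro measurable_translation measurable_linear_image[OF 2] 1)
  show "measure lebesgue (g ` S) = r\<^sup>2 * measure lebesgue S"
    unfolding im measure_translation
    by (simp add: measure_linear_image[OF 2] 1 det_matrix_scaleR)
qed

lemma similarity_negligible:
  fixes g :: "real^2 \<Rightarrow> real^2"
  assumes g: "similarity r g" and S: "negligible S"
  shows "negligible (g ` S)"
  using similarity_lmeasurable[OF g, of S] similarity_measure[OF g, of S] S
  by (simp add: negligible_iff_measure)

section \<open>Divided prototiles\<close>

definition act :: "(real^2 \<Rightarrow> real^2) \<Rightarrow> 'n tile \<Rightarrow> 'n tile" where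
  "act g t = (fst t, g \<circ> snd t)"

lemma fst_act [simp]: "fst (act g t) = fst t" and snd_act [simp]: "snd (act g t) = g \<circ> snd t"
  by (simp_all add: act_def)

lemma tile_region_act: "tile_region p (act g t) = g ` tile_region p t"
  by (simp add: tile_region_def image_comp)

lemma tile_vertices_act: "tile_vertices v (act g t) = g ` tile_vertices v t"
  by (simp add: tile_vertices_def image_comp)

lemma inj_act: "inj g \<Longrightarrow> inj (act g)"
  by (auto simp: inj_def act_def fun_eq_iff prod_eq_iff)

text \<open>As a union of images under \<open>act\<close>, subdivision visibly commutes with unions
  and with the action of maps of the plane.\<close>

lemma divide_tiles_eq:
  "divide_tiles lam \<omega> T =
     (\<Union>t\<in>T. act (snd t) ` act ((*\<^sub>R) (inverse lam)) ` \<omega> (fst t))" (is "_ = ?R")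
proof
  show "divide_tiles lam \<omega> T \<subseteq> ?R"
  proof
    fix s assume "s \<in> divide_tiles lam \<omega> T"
    then obtain i h j g where *: "s = (i, \<lambda>a. g (inverse lam *\<^sub>R h a))" "(j, g) \<in> T" "(i, h) \<in> \<omega> j"
      unfolding divide_tiles_def by blast
    then have "s = act g (act ((*\<^sub>R) (inverse lam)) (i, h))"
      by (simp add: act_def comp_def)
    then show "s \<in> ?R"
      using * by (intro UN_I[of "(j, g)"]) auto
  qed
  show "?R \<subseteq> divide_tiles lam \<omega> T"
    unfolding divide_tiles_def by (force simp: act_def comp_def)
qed

lemma act_act: "act g (act h t) = act (g \<circ> h) t"
  by (simp add: act_def comp_assoc)

lemma divide_tiles_UN: "divide_tiles lam \<omega> (\<Union>i\<in>I. F i) = (\<Union>i\<in>I. divide_tiles lam \<omega> (F i))"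
  by (simp add: divide_tiles_eq)

lemma divide_tiles_act: "divide_tiles lam \<omega> (act g ` T) = act g ` divide_tiles lam \<omega> T"
  by (simp add: divide_tiles_eq image_UN image_image act_act comp_assoc)

lemma divide_tiles_pow_UN:
  "(divide_tiles lam \<omega> ^^ k) (\<Union>i\<in>I. F i) = (\<Union>i\<in>I. (divide_tiles lam \<omega> ^^ k) (F i))"
  by (induction k) (simp_all add: divide_tiles_UN)

lemma divide_tiles_pow_act:
  "(divide_tiles lam \<omega> ^^ k) (act g ` T) = act g ` (divide_tiles lam \<omega> ^^ k) T"
  by (induction k) (simp_all add: divide_tiles_act)

text \<open>Every tile is the image under its own map of an undivided prototile, and subdivision
  commutes with unions and with \<open>act\<close>.\<close>

lemma divide_tiles_pow_eq:
  "(divide_tiles lam \<omega> ^^ k) T = (\<Union>t\<in>T. act (snd t) ` rescaled_patch lam \<omega> k (fst t))"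
proof -
  have T: "T = (\<Union>t\<in>T. act (snd t) ` {(fst t, id)})"
    by (auto simp: act_def)
  show ?thesis
    by (subst T) (simp only: divide_tiles_pow_UN divide_tiles_pow_act rescaled_patch_def)
qed

lemma rescaled_patch_0: "rescaled_patch lam \<omega> 0 j = {(j, id)}"
  by (simp add: rescaled_patch_def)

text \<open>Self-similarity: each tile of level \<open>n\<close> is divided \<open>k\<close> further
  times in the way its prototile is. Later \<open>n\<close> is fixed while \<open>k\<close>
  grows.\<close>

lemma rescaled_patch_add:
  "rescaled_patch lam \<omega> (n + k) j =
     (\<Union>t\<in>rescaled_patch lam \<omega> n j. act (snd t) ` rescaled_patch lam \<omega> k (fst t))"
  unfolding divide_tiles_pow_eq[symmetric]
  by (simp add: rescaled_patch_def add.commute[of n] funpow_add)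

lemma rescaled_patch_1: "rescaled_patch lam \<omega> (Suc 0) j = act ((*\<^sub>R) (inverse lam)) ` \<omega> j"
  by (simp add: rescaled_patch_def divide_tiles_eq image_image act_act)

lemma tiles_eq: "tiles lam \<omega> k = (\<Union>j. rescaled_patch lam \<omega> k j)"
proof -
  have "tiles lam \<omega> k = (divide_tiles lam \<omega> ^^ k) (\<Union>j\<in>UNIV. {(j, id)})"
    by (simp add: tiles_def UNION_singleton_eq_range)
  then show ?thesis
    by (simp only: divide_tiles_pow_UN rescaled_patch_def)
qed

section \<open>Patches: tilings of a region by tiles of one common ratio\<close>

definition patch :: "('n \<Rightarrow> (real^2) set) \<Rightarrow> real \<Rightarrow> (real^2) set \<Rightarrow> 'n tile set \<Rightarrow> bool" where
  "patch p r S T \<longleftrightarrow>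
     finite T \<and> (\<forall>t\<in>T. similarity r (snd t)) \<and>
     pairwise (\<lambda>s t. interior (tile_region p s) \<inter> interior (tile_region p t) = {}) T \<and>
     (\<Union>t\<in>T. tile_region p t) = S"

lemma patch_act:
  assumes "patch p r S T" and g: "similarity s g"
  shows "patch p (s * r) (g ` S) (act g ` T)"
proof -
  have disj: "interior (g ` A) \<inter> interior (g ` B) = {}" if "interior A \<inter> interior B = {}" for A B
    unfolding similarity_interior[OF g] using that injD[OF similarity_inj[OF g]] by blast
  have "pairwise (\<lambda>t u. interior (tile_region p t) \<inter> interior (tile_region p u) = {}) T"
    using assms(1) by (simp add: patch_def)
  then have "pairwise (\<lambda>t u. interior (tile_region p t) \<inter> interior (tile_region p u) = {}) (act g ` T)"
    unfolding pairwise_image tile_region_act by (rule pairwise_mono) (simp_all add: disj)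
  then show ?thesis
    using assms unfolding patch_def
    by (auto simp: tile_region_act similarity_comp)
qed

text \<open>New tiles inside one \<open>t\<close> have disjoint interiors by the patch property of
  \<open>F t\<close>; new tiles inside different \<open>t\<close> inherit this from the tiles that
  contain them.\<close>

lemma patch_UN:
  assumes T: "patch p r S T" and F: "\<And>t. t \<in> T \<Longrightarrow> patch p s (tile_region p t) (F t)"
  shows "patch p s S (\<Union>t\<in>T. F t)"
  unfolding patch_def
proof (intro conjI)
  show "pairwise (\<lambda>s t. interior (tile_region p s) \<inter> interior (tile_region p t) = {}) (\<Union>t\<in>T. F t)"
  proof (rule pairwiseI)
    fix u u' assume u: "u \<in> (\<Union>t\<in>T. F t)" "u' \<in> (\<Union>t\<in>T. F t)" "u \<noteq> u'"
    then obtain t t' where t: "t \<in> T" "u \<in> F t" "t' \<in> T" "u' \<in> F t'" by blast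
    show "interior (tile_region p u) \<inter> interior (tile_region p u') = {}"
    proof (cases "t = t'")
      case True
      then show ?thesis using F[OF t(1)] t u(3) unfolding patch_def pairwise_def by blast
    next
      case False
      then have "interior (tile_region p t) \<inter> interior (tile_region p t') = {}"
        using T t unfolding patch_def pairwise_def by blast
      moreover have "tile_region p u \<subseteq> tile_region p t" "tile_region p u' \<subseteq> tile_region p t'"
        using F[OF t(1)] F[OF t(3)] t unfolding patch_def by blast+
      ultimately show ?thesis
        using interior_mono by blast
    qed
  qed
qed (use T F in \<open>auto simp: patch_def\<close>)

text \<open>Polygons enter through three geometric properties. The null frontier makes overlaps of
  tiles null sets and, later, makes tiles along the boundary rare.\<close>

locale tiling_substitution =
  fixes p :: "'n::finite \<Rightarrow> (real^2) set" and lam :: real and \<omega> :: "'n \<Rightarrow> 'n tile set"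
  assumes compact_p: "compact (p i)"
    and interior_p: "interior (p i) \<noteq> {}"
    and negligible_frontier_p: "negligible (frontier (p i))"
    and subst: "is_substitution p lam \<omega>"
begin

abbreviation R :: "nat \<Rightarrow> 'n \<Rightarrow> 'n tile set" where "R \<equiv> rescaled_patch lam \<omega>"

definition \<mu> :: real where "\<mu> = inverse lam"

abbreviation area :: "'n \<Rightarrow> real" where "area i \<equiv> measure lebesgue (p i)"

lemma \<mu>_pos: "0 < \<mu>" and \<mu>_less_1: "\<mu> < 1"
  using subst by (auto simp: \<mu>_def is_substitution_def inverse_less_1_iff)

lemma area_pos: "0 < area i"
proof -
  have "\<not> negligible (p i)"
    using open_not_negligible[OF open_interior interior_p] negligible_subset interior_subset by blast
  then show ?thesis
    using negligible_iff_measure0[OF lmeasurable_compact[OF compact_p]] measure_nonneg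
    by (metis order_less_le)
qed

lemma patch_rescaled_patch: "patch p (\<mu> ^ k) (p j) (R k j)"
proof (induction k)
  case 0
  show ?case
    by (simp add: rescaled_patch_0 patch_def similarity_id tile_region_def)
next
  case (Suc k)
  \<comment> \<open>One subdivision: \<open>\<omega> i\<close> is a patch of ratio 1 on the enlarged
    prototile, and scaling by \<open>\<mu>\<close> brings it back onto \<open>p i\<close>. The
    induction transports this patch into every tile of level \<open>k\<close>.\<close>
  have "patch p \<mu> (p i) (R (Suc 0) i)" for i
  proof -
    have "patch p 1 ((\<lambda>a. lam *\<^sub>R a) ` p i) (\<omega> i)"
      using subst unfolding is_substitution_def patch_def similarity_def case_prod_unfold by simp
    moreover have "similarity \<mu> ((*\<^sub>R) \<mu> :: real^2 \<Rightarrow> _)"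
      using \<mu>_pos by (simp add: similarity_def dist_norm flip: scaleR_diff_right)
    ultimately have "patch p (\<mu> * 1) ((*\<^sub>R) \<mu> ` (\<lambda>a. lam *\<^sub>R a) ` p i) (act ((*\<^sub>R) \<mu>) ` \<omega> i)"
      by (rule patch_act)
    then show ?thesis
      using \<mu>_pos by (simp add: rescaled_patch_1 image_image \<mu>_def)
  qed
  then have "patch p (\<mu> ^ Suc k) (tile_region p t) (act (snd t) ` R (Suc 0) (fst t))"
    if "t \<in> R k j" for t
    using Suc that patch_act[of p \<mu> "p (fst t)" "R (Suc 0) (fst t)" "\<mu> ^ k" "snd t"]
    by (simp add: patch_def tile_region_def mult.commute)
  with patch_UN[OF Suc] show ?case
    using rescaled_patch_add[of lam \<omega> k "Suc 0" j] by simp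
qed

section \<open>Geometry, area and integrals over the tiles of a divided prototile\<close>

lemma finite_R: "finite (R k j)"
  and similarity_R: "t \<in> R k j \<Longrightarrow> similarity (\<mu> ^ k) (snd t)"
  and pairwise_R: "pairwise (\<lambda>s t. interior (tile_region p s) \<inter> interior (tile_region p t) = {}) (R k j)"
  and Union_R: "(\<Union>t\<in>R k j. tile_region p t) = p j"
  using patch_rescaled_patch[of k j] by (auto simp: patch_def)

lemma region_subset: "t \<in> R k j \<Longrightarrow> tile_region p t \<subseteq> p j"
  using Union_R by blast

lemma compact_region: "t \<in> R k j \<Longrightarrow> compact (tile_region p t)"
  unfolding tile_region_def
  by (intro compact_continuous_image similarity_continuous_on[OF similarity_R] compact_p)

lemma interior_region: "t \<in> R k j \<Longrightarrow> interior (tile_region p t) = snd t ` interior (p (fst t))"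
  unfolding tile_region_def by (rule similarity_interior[OF similarity_R])

lemma frontier_region: "t \<in> R k j \<Longrightarrow> frontier (tile_region p t) = snd t ` frontier (p (fst t))"
  unfolding tile_region_def by (rule similarity_frontier[OF similarity_R compact_p])

lemma measure_region: "t \<in> R k j \<Longrightarrow> measure lebesgue (tile_region p t) = (\<mu> ^ k)\<^sup>2 * area (fst t)"
  unfolding tile_region_def
  by (rule similarity_measure[OF similarity_R lmeasurable_compact[OF compact_p]])

text \<open>A common point lies in both closures but cannot lie in both interiors.\<close>

lemma region_Int_subset:
  assumes "s \<in> R k j" "t \<in> R k j" "s \<noteq> t"
  shows "tile_region p s \<inter> tile_region p t \<subseteq> frontier (tile_region p s) \<union> frontier (tile_region p t)"
proof -
  have "interior (tile_region p s) \<inter> interior (tile_region p t) = {}"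
    using pairwise_R[of k j] assms by (auto simp: pairwise_def)
  then show ?thesis
    using closure_subset[of "tile_region p s"] closure_subset[of "tile_region p t"]
    unfolding frontier_def by blast
qed

lemma negligible_region_Int:
  "pairwise (\<lambda>s t. negligible (tile_region p s \<inter> tile_region p t)) (R k j)"
proof (rule pairwiseI)
  fix s t assume st: "s \<in> R k j" "t \<in> R k j" "s \<noteq> t"
  have "negligible (frontier (tile_region p u))" if "u \<in> R k j" for u
    unfolding frontier_region[OF that]
    by (rule similarity_negligible[OF similarity_R[OF that] negligible_frontier_p])
  then show "negligible (tile_region p s \<inter> tile_region p t)"
    using st by (intro negligible_subset[OF negligible_Un region_Int_subset[OF st]])
qed

lemma integral_R:
  fixes f :: "real^2 \<Rightarrow> real"
  assumes f: "continuous_on (p j) f"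
  shows "integral (p j) f = (\<Sum>t\<in>R k j. integral (tile_region p t) f)"
proof -
  have "f integrable_on tile_region p t" if "t \<in> R k j" for t
    using continuous_on_subset[OF f region_subset[OF that]] compact_region[OF that]
    by (intro set_borel_integral_eq_integral(1)) (simp only: set_integrable_def borel_integrable_compact)
  then show ?thesis
    using has_integral_UN[OF finite_R _ negligible_region_Int, of k j f "\<lambda>t. integral (tile_region p t) f"]
    by (simp add: Union_R integrable_integral integral_unique)
qed

lemma sum_area_R: "(\<Sum>t\<in>R k j. (\<mu> ^ k)\<^sup>2 * area (fst t)) = area j"
proof -
  have "measure lebesgue (\<Union>t\<in>R k j. tile_region p t) = (\<Sum>t\<in>R k j. measure lebesgue (tile_region p t))"
    by (intro measure_negligible_finite_Union_image finite_R lmeasurable_compact compact_region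
        negligible_region_Int)
  then show ?thesis
    by (simp add: Union_R measure_region)
qed

text \<open>Patches are sets, so it must be excluded that two tiles of level \<open>n\<close>
  produce the same smaller tile: its nonempty interior would lie in the disjoint interiors of
  both.\<close>

lemma sum_R_add:
  "(\<Sum>u\<in>R (n + k) j. F u) = (\<Sum>t\<in>R n j. \<Sum>u\<in>R k (fst t). F (act (snd t) u))"
proof -
  have "act (snd s) ` R k (fst s) \<inter> act (snd t) ` R k (fst t) = {}"
    if st: "s \<in> R n j" "t \<in> R n j" "s \<noteq> t" for s t
  proof (rule ccontr)
    assume "act (snd s) ` R k (fst s) \<inter> act (snd t) ` R k (fst t) \<noteq> {}"
    then obtain u where u: "u \<in> act (snd s) ` R k (fst s)" "u \<in> act (snd t) ` R k (fst t)"
      by blast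
    have sub: "tile_region p u \<subseteq> tile_region p s'" if "u \<in> act (snd s') ` R k (fst s')" for s'
    proof -
      obtain w where "w \<in> R k (fst s')" "u = act (snd s') w"
        using \<open>u \<in> act (snd s') ` R k (fst s')\<close> by blast
      then show ?thesis
        using image_mono[OF region_subset[of w k "fst s'"], of "snd s'"]
        by (simp add: tile_region_act) (simp add: tile_region_def)
    qed
    have "u \<in> R (n + k) j"
      using u st by (auto simp: rescaled_patch_add)
    then have "interior (tile_region p u) \<noteq> {}"
      by (simp add: interior_region interior_p)
    moreover have "interior (tile_region p s) \<inter> interior (tile_region p t) = {}"
      using pairwise_R[of n j] st by (auto simp: pairwise_def)
    ultimately show False
      using interior_mono[OF sub[OF u(1)]] interior_mono[OF sub[OF u(2)]] by blast
  qed
  then have "(\<Sum>u\<in>R (n + k) j. F u) = (\<Sum>t\<in>R n j. \<Sum>u\<in>act (snd t) ` R k (fst t). F u)"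
    unfolding rescaled_patch_add
    by (intro sum.UNION_disjoint) (auto simp: finite_R)
  also have "\<dots> = (\<Sum>t\<in>R n j. \<Sum>u\<in>R k (fst t). F (act (snd t) u))"
    by (intro sum.cong refl sum.reindex_cong[of "act _"] inj_on_subset[OF inj_act subset_UNIV])
       (auto intro: similarity_inj similarity_R)
  finally show ?thesis .
qed

end

section \<open>Contraction and equidistribution\<close>

text \<open>Iterating the step \<open>n\<close> times from beyond \<open>N\<close> leaves
  \<open>q ^ n * C\<close> plus accumulated errors, which the geometric factor keeps below half of
  the target.\<close>

lemma tendsto_0_contraction:
  fixes d e :: "nat \<Rightarrow> real"
  assumes q: "0 \<le> q" "q < 1" and d: "\<And>k. 0 \<le> d k" "\<And>k. d k \<le> C"
    and step: "\<And>k. d (M + k) \<le> q * d k + e k" and e: "e \<longlonglongrightarrow> 0"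
  shows "d \<longlonglongrightarrow> 0"
proof (rule LIMSEQ_I)
  fix \<epsilon> :: real assume \<epsilon>: "0 < \<epsilon>"
  \<comment> \<open>With errors below this bound, \<open>\<epsilon> / 2\<close> is a fixed point of
    the map that multiplies by \<open>q\<close> and adds the bound, so the accumulated error stays
    below it.\<close>
  have "0 < \<epsilon> / 2 * (1 - q)"
    using \<epsilon> q by simp
  from LIMSEQ_D[OF e this] obtain N where N: "e k < \<epsilon> / 2 * (1 - q)" if "k \<ge> N" for k
    by (metis abs_less_iff diff_zero real_norm_def)
  have "d k \<le> q ^ n * C + \<epsilon> / 2" if "k \<ge> N + n * M" for n k
    using that
  proof (induction n arbitrary: k)
    case 0
    then show ?case using d(2)[of k] \<epsilon> by simp
  next
    case (Suc n)
    define l where "l = k - M"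
    have l: "k = M + l" "l \<ge> N + n * M"
      using Suc.prems by (auto simp: l_def)
    have "d k \<le> q * d l + e l"
      using step l by simp
    also have "\<dots> \<le> q * (q ^ n * C + \<epsilon> / 2) + \<epsilon> / 2 * (1 - q)"
      using Suc.IH[OF l(2)] N[of l] l(2) q by (intro add_mono mult_left_mono) auto
    finally show ?case by (simp add: field_simps)
  qed
  moreover have "(\<lambda>n. q ^ n * C) \<longlonglongrightarrow> 0"
    using q by (intro tendsto_mult_left_zero LIMSEQ_power_zero) simp
  from LIMSEQ_D[OF this, of "\<epsilon> / 2"] obtain n where "q ^ n * C < \<epsilon> / 2"
    using \<epsilon> by (metis abs_less_iff diff_zero half_gt_zero order_refl real_norm_def)
  ultimately have "norm (d k - 0) < \<epsilon>" if "k \<ge> N + n * M" for k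
    using that d(1)[of k] by fastforce
  then show "\<exists>no. \<forall>k\<ge>no. norm (d k - 0) < \<epsilon>" by blast
qed

text \<open>A Doeblin-type argument: all rows of \<open>P\<close> share the mass
  \<open>\<eta>\<close> in every entry. This shared part contributes equally to all averages, so
  only the remaining mass \<open>q\<close> per row can produce a difference.\<close>

lemma stochastic_recursion_oscillation:
  fixes w :: "nat \<Rightarrow> 'n::finite \<Rightarrow> real" and P :: "'n \<Rightarrow> 'n \<Rightarrow> real"
  assumes w: "\<And>k i. \<bar>w k i\<bar> \<le> C"
    and \<eta>: "0 < \<eta>" "\<And>j i. \<eta> \<le> P j i" and P: "\<And>j. (\<Sum>i\<in>UNIV. P j i) = 1"
    and rec: "\<And>j. (\<lambda>k. w (M + k) j - (\<Sum>i\<in>UNIV. P j i * w k i)) \<longlonglongrightarrow> 0"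
  shows "(\<lambda>k. w k i - w k j) \<longlonglongrightarrow> 0"
proof -
  define hi lo where "hi k = Max (range (w k))" and "lo k = Min (range (w k))" for k
  define q where "q = 1 - real CARD('n) * \<eta>"
  define E where "E k = (\<Sum>j\<in>UNIV. \<bar>w (M + k) j - (\<Sum>i\<in>UNIV. P j i * w k i)\<bar>)" for k
  have hi: "w k i \<le> hi k" and lo: "lo k \<le> w k i" for k i
    by (auto simp: hi_def lo_def)
  have hi_attained: "\<exists>i. hi k = w k i" for k
  proof -
    have "hi k \<in> range (w k)"
      unfolding hi_def by (intro Max_in) auto
    then show ?thesis by blast
  qed
  have lo_attained: "\<exists>i. lo k = w k i" for k
  proof -
    have "lo k \<in> range (w k)"
      unfolding lo_def by (intro Min_in) auto
    then show ?thesis by blast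
  qed
  have sum_P: "(\<Sum>i\<in>UNIV. P j i - \<eta>) = q" for j
    by (simp add: sum_subtractf P q_def)
  have E: "\<bar>w (M + k) j - (\<Sum>i\<in>UNIV. P j i * w k i)\<bar> \<le> E k" for k j
    unfolding E_def by (intro member_le_sum) auto
  \<comment> \<open>The last two summands do not depend on \<open>j\<close>; the first lies between
    0 and \<open>q * (hi k - lo k)\<close>.\<close>
  have split: "(\<Sum>i\<in>UNIV. P j i * w k i)
      = (\<Sum>i\<in>UNIV. (P j i - \<eta>) * (w k i - lo k)) + \<eta> * (\<Sum>i\<in>UNIV. w k i - lo k) + lo k" for j k
  proof -
    have "(\<Sum>i\<in>UNIV. P j i * w k i)
      = (\<Sum>i\<in>UNIV. (P j i - \<eta>) * (w k i - lo k) + \<eta> * (w k i - lo k) + P j i * lo k)"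
      by (intro sum.cong) (auto simp: algebra_simps)
    then show ?thesis
      by (simp add: sum.distrib sum_distrib_left[symmetric] sum_distrib_right[symmetric] P)
  qed
  have lower: "0 \<le> (\<Sum>i\<in>UNIV. (P j i - \<eta>) * (w k i - lo k))" for j k
    using \<eta>(2) lo by (intro sum_nonneg mult_nonneg_nonneg) auto
  have upper: "(\<Sum>i\<in>UNIV. (P j i - \<eta>) * (w k i - lo k)) \<le> q * (hi k - lo k)" for j k
  proof -
    have "(\<Sum>i\<in>UNIV. (P j i - \<eta>) * (w k i - lo k)) \<le> (\<Sum>i\<in>UNIV. (P j i - \<eta>) * (hi k - lo k))"
      using \<eta>(2) hi by (intro sum_mono mult_left_mono) auto
    then show ?thesis
      by (simp add: sum_distrib_right[symmetric] sum_P)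
  qed
  have "(\<lambda>k. hi k - lo k) \<longlonglongrightarrow> 0"
  proof (rule tendsto_0_contraction)
    show "0 \<le> q"
      using sum_nonneg[of UNIV "\<lambda>i. P undefined i - \<eta>"] \<eta>(2) sum_P[of undefined] by simp
    show "q < 1"
      using \<eta>(1) by (simp add: q_def)
    show "0 \<le> hi k - lo k" for k
      using hi[of k undefined] lo[of k undefined] by simp
    show "hi k - lo k \<le> 2 * C" for k
    proof -
      obtain i j where "hi k = w k i" "lo k = w k j"
        using hi_attained lo_attained by metis
      then show ?thesis using w[of k i] w[of k j] by simp
    qed
    \<comment> \<open>At the types attaining maximum and minimum, the terms independent of the row
      cancel; each of the two values costs one recursion error.\<close>
    show "hi (M + k) - lo (M + k) \<le> q * (hi k - lo k) + 2 * E k" for k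
    proof -
      obtain i j where "hi (M + k) = w (M + k) i" "lo (M + k) = w (M + k) j"
        using hi_attained lo_attained by metis
      then show ?thesis
        using E[of k i] E[of k j] split[of i k] split[of j k] lower[of j k] upper[of i k] by linarith
    qed
    have "E \<longlonglongrightarrow> (\<Sum>j\<in>(UNIV :: 'n set). 0)"
      unfolding E_def by (intro tendsto_sum tendsto_rabs_zero rec)
    then show "(\<lambda>k. 2 * E k) \<longlonglongrightarrow> 0"
      by (intro tendsto_mult_right_zero) simp
  qed
  then show ?thesis
  proof (rule Lim_null_comparison[rotated], intro always_eventually allI)
    show "norm (w k i - w k j) \<le> hi k - lo k" for k
      using hi[of k i] hi[of k j] lo[of k i] lo[of k j] by simp
  qed
qed

text \<open>The shift \<open>n\<close> and the null sequence \<open>g\<close> may depend on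
  \<open>\<epsilon>\<close>: first a level fine enough for \<open>f\<close> is fixed, then the depth
  \<open>k\<close> tends to infinity.\<close>

lemma tendsto_0_approx:
  fixes h :: "nat \<Rightarrow> real"
  assumes "\<And>\<epsilon>. 0 < \<epsilon> \<Longrightarrow> \<exists>n g. g \<longlonglongrightarrow> 0 \<and> (\<forall>k. \<bar>h (n + k)\<bar> \<le> \<bar>g k\<bar> + \<epsilon>)"
  shows "h \<longlonglongrightarrow> 0"
proof (rule LIMSEQ_I)
  fix \<epsilon> :: real assume "0 < \<epsilon>"
  then obtain n g where g: "g \<longlonglongrightarrow> 0" and h: "\<And>k. \<bar>h (n + k)\<bar> \<le> \<bar>g k\<bar> + \<epsilon> / 2"
    using assms[of "\<epsilon> / 2"] by auto
  obtain N where N: "\<bar>g k\<bar> < \<epsilon> / 2" if "k \<ge> N" for k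
    using LIMSEQ_D[OF g, of "\<epsilon> / 2"] \<open>0 < \<epsilon>\<close> by auto
  have "norm (h k - 0) < \<epsilon>" if "k \<ge> n + N" for k
  proof -
    have "\<bar>g (k - n)\<bar> < \<epsilon> / 2"
      using that by (intro N) simp
    then show ?thesis
      using h[of "k - n"] that by simp
  qed
  then show "\<exists>no. \<forall>k\<ge>no. norm (h k - 0) < \<epsilon>" by blast
qed

section \<open>Fine tiles, Riemann sums and the abstract equidistribution result\<close>

context tiling_substitution
begin

text \<open>A common bound for the diameters of all prototiles; the summand 1 makes it
  positive.\<close>

definition D :: real where "D = 1 + (\<Sum>i\<in>UNIV. diameter (p i))"

lemma D_pos: "0 < D"
  unfolding D_def
  by (intro add_pos_nonneg sum_nonneg) (auto intro: diameter_ge_0 compact_imp_bounded compact_p)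

lemma dist_region_le:
  assumes t: "t \<in> R k j" and ab: "a \<in> tile_region p t" "b \<in> tile_region p t"
  shows "dist a b \<le> \<mu> ^ k * D"
proof -
  obtain a' b' where a'b': "a = snd t a'" "b = snd t b'" "a' \<in> p (fst t)" "b' \<in> p (fst t)"
    using ab by (auto simp: tile_region_def)
  have "dist a' b' \<le> diameter (p (fst t))"
    by (intro diameter_bounded_bound compact_imp_bounded compact_p a'b')
  also have "\<dots> \<le> (\<Sum>i\<in>UNIV. diameter (p i))"
    by (intro member_le_sum) (auto intro: diameter_ge_0 compact_imp_bounded compact_p)
  finally have "dist a' b' \<le> D"
    by (simp add: D_def)
  then show ?thesis
    using a'b' \<mu>_pos by (simp add: similarity_dist[OF similarity_R[OF t]])
qed

lemma power_mult_D_tendsto: "(\<lambda>n. \<mu> ^ n * D) \<longlonglongrightarrow> 0"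
  using \<mu>_pos \<mu>_less_1 by (intro tendsto_mult_left_zero LIMSEQ_power_zero) simp

text \<open>Uniform continuity on the compact prototile, combined with tile diameters of at most
  \<open>\<mu> ^ n * D\<close>.\<close>

lemma region_oscillation:
  fixes f :: "real^2 \<Rightarrow> real"
  assumes f: "continuous_on (p j) f" and "0 < \<epsilon>"
  shows "\<exists>n. \<forall>t\<in>R n j. \<forall>a\<in>tile_region p t. \<forall>b\<in>tile_region p t. \<bar>f a - f b\<bar> \<le> \<epsilon>"
proof -
  obtain \<delta> where \<delta>: "0 < \<delta>" "\<And>a b. a \<in> p j \<Longrightarrow> b \<in> p j \<Longrightarrow> dist a b < \<delta> \<Longrightarrow> dist (f a) (f b) < \<epsilon>"
    using compact_uniformly_continuous[OF f compact_p] \<open>0 < \<epsilon>\<close>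
    unfolding uniformly_continuous_on_def by metis
  from LIMSEQ_D[OF power_mult_D_tendsto \<delta>(1)] obtain n where n: "\<mu> ^ n * D < \<delta>"
    by (auto simp: abs_less_iff)
  show ?thesis
  proof (intro exI[of _ n] ballI)
    fix t a b assume t: "t \<in> R n j" and ab: "a \<in> tile_region p t" "b \<in> tile_region p t"
    have "dist (f a) (f b) < \<epsilon>"
      using \<delta>(2)[of a b] n dist_region_le[OF t ab] ab region_subset[OF t] by auto
    then show "\<bar>f a - f b\<bar> \<le> \<epsilon>"
      by (simp add: dist_real_def)
  qed
qed

text \<open>On each tile the integral is compared with those of the constants
  \<open>c t - \<epsilon>\<close> and \<open>c t + \<epsilon>\<close>; the errors add up to the
  total area times \<open>\<epsilon>\<close>.\<close>

lemma riemann_sum_region: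
  fixes f :: "real^2 \<Rightarrow> real"
  assumes f: "continuous_on (p j) f"
    and osc: "\<And>t a. t \<in> R n j \<Longrightarrow> a \<in> tile_region p t \<Longrightarrow> \<bar>f a - c t\<bar> \<le> \<epsilon>"
  shows "\<bar>(\<Sum>t\<in>R n j. (\<mu> ^ n)\<^sup>2 * area (fst t) * c t) - integral (p j) f\<bar> \<le> \<epsilon> * area j"
proof -
  have "\<bar>(\<mu> ^ n)\<^sup>2 * area (fst t) * c t - integral (tile_region p t) f\<bar> \<le> \<epsilon> * ((\<mu> ^ n)\<^sup>2 * area (fst t))"
    if t: "t \<in> R n j" for t
  proof -
    have 1: "f integrable_on tile_region p t"
      using continuous_on_subset[OF f region_subset[OF t]] compact_region[OF t]
      by (intro set_borel_integral_eq_integral(1)) (simp only: set_integrable_def borel_integrable_compact)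
    have lm: "tile_region p t \<in> lmeasurable"
      by (rule lmeasurable_compact[OF compact_region[OF t]])
    have const: "((\<lambda>_. d) has_integral (d * ((\<mu> ^ n)\<^sup>2 * area (fst t)))) (tile_region p t)" for d :: real
      using has_integral_mult_right[OF integrable_integral[OF lmeasurable_iff_integrable_on[THEN iffD1, OF lm]], of d]
      by (simp add: measure_region[OF t] flip: lmeasure_integral[OF lm])
    have "integral (tile_region p t) f \<le> (c t + \<epsilon>) * ((\<mu> ^ n)\<^sup>2 * area (fst t))"
      using osc[OF t] by (intro has_integral_le[OF integrable_integral[OF 1] const]) (fastforce simp: abs_le_iff)
    moreover have "(c t - \<epsilon>) * ((\<mu> ^ n)\<^sup>2 * area (fst t)) \<le> integral (tile_region p t) f"
      using osc[OF t] by (intro has_integral_le[OF const integrable_integral[OF 1]]) (fastforce simp: abs_le_iff)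
    ultimately show ?thesis
      by (simp add: abs_le_iff algebra_simps)
  qed
  then have "\<bar>\<Sum>t\<in>R n j. (\<mu> ^ n)\<^sup>2 * area (fst t) * c t - integral (tile_region p t) f\<bar>
      \<le> (\<Sum>t\<in>R n j. \<epsilon> * ((\<mu> ^ n)\<^sup>2 * area (fst t)))"
    by (intro order_trans[OF sum_abs] sum_mono)
  then show ?thesis
    by (simp only: integral_R[OF f, of n] sum_subtractf sum_distrib_left[symmetric, of \<epsilon>] sum_area_R)
qed


text \<open>\<open>\<Phi> k j f\<close> stands for the sum of \<open>f\<close> over the marked
  points of prototile \<open>j\<close> after \<open>k\<close> divisions. The assumptions isolate
  what all three kinds of marked points share: \<open>local\<close> controls nearly constant
  functions, \<open>add\<close> is additivity over tiles up to \<open>o(1)\<close> after scaling,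
  and \<open>c\<close>, \<open>C\<close> fix the order of growth.\<close>

lemma equidistribution:
  fixes \<Phi> :: "nat \<Rightarrow> 'n \<Rightarrow> (real^2 \<Rightarrow> real) \<Rightarrow> real"
  assumes prim: "primitive_substitution lam \<omega>"
    and local: "\<And>k i f c \<epsilon>. (\<And>a. a \<in> p i \<Longrightarrow> \<bar>f a - c\<bar> \<le> \<epsilon>) \<Longrightarrow>
        \<bar>\<Phi> k i f - c * \<Phi> k i (\<lambda>_. 1)\<bar> \<le> \<epsilon> * \<Phi> k i (\<lambda>_. 1)"
    and add: "\<And>n j f B. (\<And>a. a \<in> p j \<Longrightarrow> \<bar>f a\<bar> \<le> B) \<Longrightarrow>
        (\<lambda>k. (\<mu> ^ k)\<^sup>2 * (\<Phi> (n + k) j f - (\<Sum>t\<in>R n j. \<Phi> k (fst t) (f \<circ> snd t)))) \<longlonglongrightarrow> 0"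
    and c: "0 < c" "\<And>k i. c \<le> (\<mu> ^ k)\<^sup>2 * \<Phi> k i (\<lambda>_. 1)"
    and C: "\<And>k i. (\<mu> ^ k)\<^sup>2 * \<Phi> k i (\<lambda>_. 1) \<le> C"
    and f: "\<And>j. continuous_on (p j) f"
  shows "(\<lambda>k. (\<Sum>j\<in>UNIV. \<Phi> k j f) / (\<Sum>j\<in>UNIV. \<Phi> k j (\<lambda>_. 1)))
           \<longlonglongrightarrow> (\<Sum>j\<in>UNIV. integral (p j) f) / (\<Sum>j\<in>UNIV. area j)"
proof -
  \<comment> \<open>Rescaled number of marked points per unit area.\<close>
  define w where "w k i = (\<mu> ^ k)\<^sup>2 * \<Phi> k i (\<lambda>_. 1) / area i" for k i
  \<comment> \<open>The share of the area of \<open>p j\<close> taken by a tile \<open>t\<close> of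
    level \<open>n\<close>; these shares are the averaging weights.\<close>
  define \<kappa> where "\<kappa> n j t = (\<mu> ^ n)\<^sup>2 * area (fst t) / area j" for n j and t :: "'n tile"
  define a0 where "a0 = Min (range area)"
  \<comment> \<open>An arbitrary type serves as reference: once oscillation vanishes, its density
    represents that of every type.\<close>
  define W where "W k = w k undefined" for k
  have a0: "0 < a0" "a0 \<le> area i" for i
    using area_pos by (auto simp: a0_def)
  have C_nonneg: "0 \<le> C"
    using c C by (meson less_le_trans less_imp_le)
  have w_pos: "0 \<le> w k i" for k i
    using c less_imp_le[OF area_pos[of i]] unfolding w_def
    by (intro divide_nonneg_nonneg) (auto intro: order_trans[OF less_imp_le])
  have w_le: "w k i \<le> C / a0" for k i
    unfolding w_def using C C_nonneg a0 by (intro frac_le) auto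
  have w_area: "(\<mu> ^ k)\<^sup>2 * \<Phi> k i (\<lambda>_. 1) = area i * w k i" for k i
    using area_pos[of i] by (simp add: w_def)
  have sum_\<kappa>: "(\<Sum>t\<in>R n j. \<kappa> n j t) = 1" for n j
    using area_pos[of j] sum_area_R[of n j] by (simp add: \<kappa>_def flip: sum_divide_distrib)
  \<comment> \<open>This is \<open>add\<close> for the constant function 1, divided by the area of
    \<open>p j\<close>.\<close>
  have rec: "(\<lambda>k. w (n + k) j - (\<Sum>t\<in>R n j. \<kappa> n j t * w k (fst t))) \<longlonglongrightarrow> 0" for n j
  proof -
    have eq: "w (n + k) j - (\<Sum>t\<in>R n j. \<kappa> n j t * w k (fst t)) = (\<mu> ^ n)\<^sup>2 / area j *
        ((\<mu> ^ k)\<^sup>2 * (\<Phi> (n + k) j (\<lambda>_. 1) - (\<Sum>t\<in>R n j. \<Phi> k (fst t) ((\<lambda>_. 1) \<circ> snd t))))" for k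
    proof -
      have "\<kappa> n j t * w k (fst t) = (\<mu> ^ n)\<^sup>2 / area j * ((\<mu> ^ k)\<^sup>2 * \<Phi> k (fst t) (\<lambda>_. 1))" for t
        using area_pos[of "fst t"] by (simp add: \<kappa>_def w_def)
      then have "(\<Sum>t\<in>R n j. \<kappa> n j t * w k (fst t))
          = (\<mu> ^ n)\<^sup>2 / area j * ((\<mu> ^ k)\<^sup>2 * (\<Sum>t\<in>R n j. \<Phi> k (fst t) (\<lambda>_. 1)))"
        by (simp only: sum_distrib_left)
      then show ?thesis
        by (simp only:) (simp add: w_def comp_def power_add power_mult_distrib right_diff_distrib)
    qed
    then show ?thesis
      unfolding eq by (intro tendsto_mult_right_zero add[of _ _ 1]) simp
  qed
  have osc: "(\<lambda>k. w k i - w k j) \<longlonglongrightarrow> 0" for i j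
  proof -
    obtain M where M: "\<And>i j. \<exists>g. (i, g) \<in> R M j"
      using prim unfolding primitive_substitution_def by blast
    \<comment> \<open>The weights of level \<open>M\<close> are collected by type, giving a
      stochastic matrix.\<close>
    define P where "P j i = (\<Sum>t\<in>R M j. if fst t = i then \<kappa> M j t else 0)" for j i
    \<comment> \<open>The least area share of a single tile. By primitivity every type occurs in
      every divided prototile at level \<open>M\<close>, so each entry of \<open>P\<close> is at
      least this.\<close>
    define \<eta> where "\<eta> = Min (range (\<lambda>(j, i). (\<mu> ^ M)\<^sup>2 * area i / area j))"
    have \<kappa>_pos: "0 < \<kappa> n j t" for n j t
      using area_pos \<mu>_pos by (simp add: \<kappa>_def)
    have sum_P: "(\<Sum>i\<in>UNIV. P j i * x i) = (\<Sum>t\<in>R M j. \<kappa> M j t * x (fst t))" for j x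
    proof -
      have "(\<Sum>i\<in>UNIV. P j i * x i) = (\<Sum>t\<in>R M j. \<Sum>i\<in>UNIV. (if fst t = i then \<kappa> M j t else 0) * x i)"
        unfolding P_def sum_distrib_right by (rule sum.swap)
      then show ?thesis
        by (simp add: if_distrib[of "\<lambda>y. y * _"] cong: if_cong)
    qed
    show ?thesis
    proof (rule stochastic_recursion_oscillation)
      show "\<bar>w k i\<bar> \<le> C / a0" for k i
        using w_pos w_le by simp
      show "0 < \<eta>"
        using area_pos \<mu>_pos by (auto simp: \<eta>_def)
      show "\<eta> \<le> P j i" for j i
      proof -
        obtain g where g: "(i, g) \<in> R M j" using M by blast
        have "\<eta> \<le> \<kappa> M j (i, g)"
          unfolding \<eta>_def \<kappa>_def by (intro Min_le) auto
        also have "\<dots> = (if fst (i, g) = i then \<kappa> M j (i, g) else 0)" by simp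
        also have "\<dots> \<le> P j i"
          unfolding P_def using g finite_R less_imp_le[OF \<kappa>_pos] by (intro member_le_sum) auto
        finally show ?thesis .
      qed
      show "(\<Sum>i\<in>UNIV. P j i) = 1" for j
        using sum_P[of j "\<lambda>_. 1"] sum_\<kappa> by simp
      show "(\<lambda>k. w (M + k) j - (\<Sum>i\<in>UNIV. P j i * w k i)) \<longlonglongrightarrow> 0" for j
        unfolding sum_P by (rule rec)
    qed
  qed
  have osc_W: "(\<lambda>k. \<Sum>t\<in>R n j. y t * (w k (fst t) - W k)) \<longlonglongrightarrow> 0" for n j y
  proof -
    have "(\<lambda>k. \<Sum>t\<in>R n j. y t * (w k (fst t) - W k)) \<longlonglongrightarrow> (\<Sum>t\<in>R n j. 0)"
      unfolding W_def by (intro tendsto_sum tendsto_mult_right_zero osc)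
    then show ?thesis by simp
  qed
  \<comment> \<open>The density \<open>W\<close> need not converge, but over a fixed number
    \<open>n\<close> of levels it drifts only by \<open>o(1)\<close>: \<open>w (n + k)\<close> is
    nearly an average of values close to \<open>W k\<close>.\<close>
  have shift: "(\<lambda>k. W k - W (n + k)) \<longlonglongrightarrow> 0" for n
  proof -
    have "W k - W (n + k) = - (w (n + k) undefined - (\<Sum>t\<in>R n undefined. \<kappa> n undefined t * w k (fst t)))
        - (\<Sum>t\<in>R n undefined. \<kappa> n undefined t * (w k (fst t) - W k))" for k
      using sum_\<kappa>[of n undefined]
      by (simp add: W_def right_diff_distrib sum_subtractf flip: sum_distrib_right)
    then show ?thesis
      using tendsto_diff[OF tendsto_minus[OF rec[of n undefined]] osc_W] by simp
  qed
  have W: "0 \<le> W k" "W k \<le> C / a0" for k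
    using w_pos w_le by (auto simp: W_def)
  have main: "(\<lambda>m. (\<mu> ^ m)\<^sup>2 * \<Phi> m j f - W m * integral (p j) f) \<longlonglongrightarrow> 0"
    if f: "continuous_on (p j) f" for f j
  proof (rule tendsto_0_approx)
    fix \<epsilon> :: real assume "0 < \<epsilon>"
    define b where "b = C / a0 + 1"
    have b: "0 < b" "C / a0 \<le> b"
      using C_nonneg a0(1) by (simp_all add: b_def add_nonneg_pos)
    \<comment> \<open>Chosen so that the sampling errors \<open>H\<close> and \<open>K\<close> below
      are each at most \<open>\<epsilon> / 2\<close>.\<close>
    define \<delta> where "\<delta> = \<epsilon> / (2 * b * area j)"
    have \<delta>: "0 < \<delta>"
      using \<open>0 < \<epsilon>\<close> b(1) area_pos[of j] by (simp add: \<delta>_def)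
    have "C / a0 * (\<delta> * area j) \<le> b * (\<delta> * area j)"
      using b(2) \<delta> area_pos[of j] by (intro mult_right_mono) auto
    then have \<delta>_le: "2 * (C / a0 * (\<delta> * area j)) \<le> \<epsilon>"
      using b(1) area_pos[of j] by (simp add: \<delta>_def)
    obtain n where n: "\<And>t a b. t \<in> R n j \<Longrightarrow> a \<in> tile_region p t \<Longrightarrow> b \<in> tile_region p t \<Longrightarrow> \<bar>f a - f b\<bar> \<le> \<delta>"
      using region_oscillation[OF f \<delta>] by blast
    \<comment> \<open>A sample point in each prototile; its image in a tile gives the value
      \<open>y t\<close> that replaces \<open>f\<close> on that tile.\<close>
    define z where "z i = (SOME a. a \<in> p i)" for i
    have z: "z i \<in> p i" for i
      using interior_p[of i] interior_subset unfolding z_def by (metis someI subset_empty ex_in_conv)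
    define y where "y t = f (snd t (z (fst t)))" for t
    have y: "\<bar>f a - y t\<bar> \<le> \<delta>" if "t \<in> R n j" "a \<in> tile_region p t" for t a
      unfolding y_def using that z by (intro n) (auto simp: tile_region_def)
    obtain B where B: "\<And>a. a \<in> p j \<Longrightarrow> \<bar>f a\<bar> \<le> B"
      using compact_imp_bounded[OF compact_continuous_image[OF f compact_p]]
      unfolding bounded_iff by (metis imageI real_norm_def)
    \<comment> \<open>The errors that vanish as \<open>k\<close> grows with \<open>n\<close> fixed:
      the additivity defect, the differences of density between types, and the drift of
      \<open>W\<close>.\<close>
    define G where "G k = (\<mu> ^ n)\<^sup>2 * ((\<mu> ^ k)\<^sup>2 * (\<Phi> (n + k) j f - (\<Sum>t\<in>R n j. \<Phi> k (fst t) (f \<circ> snd t))))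
        + (\<Sum>t\<in>R n j. ((\<mu> ^ n)\<^sup>2 * area (fst t) * y t) * (w k (fst t) - W k))
        + (W k - W (n + k)) * integral (p j) f" for k
    have "G \<longlonglongrightarrow> 0 + 0 + 0"
      unfolding G_def
      by (intro tendsto_add tendsto_mult_right_zero tendsto_mult_left_zero add osc_W shift) (rule B)
    moreover have "\<bar>(\<mu> ^ (n + k))\<^sup>2 * \<Phi> (n + k) j f - W (n + k) * integral (p j) f\<bar> \<le> \<bar>G k\<bar> + \<epsilon>" for k
    proof -
      \<comment> \<open>The errors controlled by the choice of \<open>n\<close>: \<open>H\<close>
        comes from replacing \<open>f\<close> by \<open>y t\<close> on each tile, \<open>K\<close>
        from replacing the integral by its Riemann sum. With \<open>G\<close> they telescope to the
        whole difference.\<close>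
      define H where "H = (\<Sum>t\<in>R n j. (\<mu> ^ n)\<^sup>2 * ((\<mu> ^ k)\<^sup>2 * (\<Phi> k (fst t) (f \<circ> snd t) - y t * \<Phi> k (fst t) (\<lambda>_. 1))))"
      define K where "K = W k * ((\<Sum>t\<in>R n j. (\<mu> ^ n)\<^sup>2 * area (fst t) * y t) - integral (p j) f)"
      have "\<bar>H\<bar> \<le> (\<Sum>t\<in>R n j. C / a0 * (\<delta> * ((\<mu> ^ n)\<^sup>2 * area (fst t))))"
        unfolding H_def
      proof (intro order_trans[OF sum_abs] sum_mono)
        fix t assume t: "t \<in> R n j"
        have "\<bar>\<Phi> k (fst t) (f \<circ> snd t) - y t * \<Phi> k (fst t) (\<lambda>_. 1)\<bar> \<le> \<delta> * \<Phi> k (fst t) (\<lambda>_. 1)"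
          using y[OF t] by (intro local) (simp add: tile_region_def)
        then have "(\<mu> ^ n)\<^sup>2 * ((\<mu> ^ k)\<^sup>2 * \<bar>\<Phi> k (fst t) (f \<circ> snd t) - y t * \<Phi> k (fst t) (\<lambda>_. 1)\<bar>)
            \<le> (\<mu> ^ n)\<^sup>2 * ((\<mu> ^ k)\<^sup>2 * (\<delta> * \<Phi> k (fst t) (\<lambda>_. 1)))"
          by (intro mult_left_mono) auto
        also have "\<dots> = (\<mu> ^ n)\<^sup>2 * area (fst t) * \<delta> * w k (fst t)"
          using w_area[of k "fst t"] by (simp add: mult_ac)
        also have "\<dots> \<le> (\<mu> ^ n)\<^sup>2 * area (fst t) * \<delta> * (C / a0)"
          using \<delta> by (intro mult_left_mono w_le) auto
        finally show "\<bar>(\<mu> ^ n)\<^sup>2 * ((\<mu> ^ k)\<^sup>2 * (\<Phi> k (fst t) (f \<circ> snd t) - y t * \<Phi> k (fst t) (\<lambda>_. 1)))\<bar>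
            \<le> C / a0 * (\<delta> * ((\<mu> ^ n)\<^sup>2 * area (fst t)))"
          by (simp add: abs_mult mult_ac)
      qed
      then have H: "\<bar>H\<bar> \<le> C / a0 * (\<delta> * area j)"
        by (simp only: sum_distrib_left[symmetric, of "C / a0"] sum_distrib_left[symmetric, of \<delta>] sum_area_R)
      have K: "\<bar>K\<bar> \<le> C / a0 * (\<delta> * area j)"
        unfolding K_def abs_mult using W[of k]
        by (intro mult_mono riemann_sum_region[OF f y]) auto
      have "(\<mu> ^ (n + k))\<^sup>2 * \<Phi> (n + k) j f - W (n + k) * integral (p j) f = G k + H + K"
      proof -
        have "H = (\<mu> ^ n)\<^sup>2 * ((\<mu> ^ k)\<^sup>2 * (\<Sum>t\<in>R n j. \<Phi> k (fst t) (f \<circ> snd t)))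
            - (\<Sum>t\<in>R n j. (\<mu> ^ n)\<^sup>2 * area (fst t) * y t * w k (fst t))"
        proof -
          have "(\<mu> ^ n)\<^sup>2 * ((\<mu> ^ k)\<^sup>2 * (\<Phi> k (fst t) (f \<circ> snd t) - y t * \<Phi> k (fst t) (\<lambda>_. 1)))
            = (\<mu> ^ n)\<^sup>2 * ((\<mu> ^ k)\<^sup>2 * \<Phi> k (fst t) (f \<circ> snd t)) - (\<mu> ^ n)\<^sup>2 * area (fst t) * y t * w k (fst t)" for t
            using w_area[of k "fst t"] by (simp add: right_diff_distrib mult_ac)
          then show ?thesis
            by (simp add: H_def sum_subtractf sum_distrib_left)
        qed
        then show ?thesis
          by (simp add: G_def K_def right_diff_distrib left_diff_distrib sum_subtractf power_add
              power_mult_distrib sum_distrib_left mult_ac)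
      qed
      then show ?thesis
        using H K \<delta>_le by linarith
    qed
    ultimately show "\<exists>n g. g \<longlonglongrightarrow> 0 \<and>
        (\<forall>k. \<bar>(\<mu> ^ (n + k))\<^sup>2 * \<Phi> (n + k) j f - W (n + k) * integral (p j) f\<bar> \<le> \<bar>g k\<bar> + \<epsilon>)"
      by (intro exI[of _ n] exI[of _ G]) simp
  qed
  define S where "S f k = (\<Sum>j\<in>UNIV. (\<mu> ^ k)\<^sup>2 * \<Phi> k j f)" for f k
  define I A where "I = (\<Sum>j\<in>UNIV. integral (p j) f)" and "A = (\<Sum>j\<in>UNIV. area j)"
  have "(\<lambda>k. S f k - W k * (\<Sum>j\<in>UNIV. integral (p j) f)) \<longlonglongrightarrow> (\<Sum>j\<in>(UNIV::'n set). 0)"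
    if "\<And>j. continuous_on (p j) f" for f
    unfolding S_def sum_distrib_left sum_subtractf[symmetric]
    by (intro tendsto_sum main that)
  from this[OF f] this[of "\<lambda>_. 1"]
  have SI: "(\<lambda>k. S f k - W k * I) \<longlonglongrightarrow> 0" and SA: "(\<lambda>k. S (\<lambda>_. 1) k - W k * A) \<longlonglongrightarrow> 0"
    by (simp_all add: I_def A_def lmeasure_integral[OF lmeasurable_compact[OF compact_p]])
  have A: "0 < A"
    unfolding A_def by (intro sum_pos area_pos) auto
  have S1: "c \<le> S (\<lambda>_. 1) k" for k
  proof -
    have "c \<le> (\<mu> ^ k)\<^sup>2 * \<Phi> k undefined (\<lambda>_. 1)" by (rule c)
    also have "\<dots> \<le> S (\<lambda>_. 1) k"
      unfolding S_def using c by (intro member_le_sum) (auto intro: order_trans[OF less_imp_le])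
    finally show ?thesis .
  qed
  \<comment> \<open>This combination cancels \<open>W k\<close> and equals
    \<open>S f k - I / A * S (\<lambda>_. 1) k\<close>. Dividing by the total count, which is
    bounded below by \<open>c\<close>, yields the limit of the quotient.\<close>
  define Z where "Z k = ((S f k - W k * I) - I / A * (S (\<lambda>_. 1) k - W k * A))" for k
  have Z: "Z \<longlonglongrightarrow> 0"
    unfolding Z_def using tendsto_diff[OF SI tendsto_mult_right_zero[OF SA, of "I / A"]] by simp
  have quot: "S f k / S (\<lambda>_. 1) k - I / A = Z k / S (\<lambda>_. 1) k" for k
    using S1[of k] c A by (simp add: Z_def field_simps)
  have "(\<lambda>k. S f k / S (\<lambda>_. 1) k - I / A) \<longlonglongrightarrow> 0"
    unfolding quot
  proof (rule Lim_null_comparison[where g = "\<lambda>k. \<bar>Z k\<bar> / c"], intro always_eventually allI)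
    show "norm (Z k / S (\<lambda>_. 1) k) \<le> \<bar>Z k\<bar> / c" for k
      using S1[of k] c by (simp add: frac_le)
    show "(\<lambda>k. \<bar>Z k\<bar> / c) \<longlonglongrightarrow> 0"
      using tendsto_divide_zero[OF tendsto_rabs_zero[OF Z]] .
  qed
  then have "(\<lambda>k. S f k / S (\<lambda>_. 1) k) \<longlonglongrightarrow> I / A"
    by (rule LIM_zero_cancel)
  moreover have "S f k / S (\<lambda>_. 1) k = (\<Sum>j\<in>UNIV. \<Phi> k j f) / (\<Sum>j\<in>UNIV. \<Phi> k j (\<lambda>_. 1))" for k
    using \<mu>_pos by (simp add: S_def flip: sum_distrib_left)
  ultimately show ?thesis
    by (simp add: I_def A_def)
qed

end

section \<open>Marked points of tiles\<close>

lemma sum_local: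
  fixes f :: "'b \<Rightarrow> real"
  assumes "\<And>a. a \<in> A \<Longrightarrow> \<bar>f a - c\<bar> \<le> \<epsilon>"
  shows "\<bar>(\<Sum>a\<in>A. f a) - c * (\<Sum>a\<in>A. 1)\<bar> \<le> \<epsilon> * (\<Sum>a\<in>A. 1)"
proof -
  have "\<bar>\<Sum>a\<in>A. f a - c\<bar> \<le> (\<Sum>a\<in>A. \<epsilon>)"
    using assms by (intro order_trans[OF sum_abs] sum_mono) auto
  then show ?thesis
    by (simp add: sum_subtractf mult.commute)
qed

text \<open>Outside the sets \<open>Y t\<close> nothing is counted twice. The points in them
  contribute at most \<open>B\<close> each, once to the union and once to the iterated sum, hence
  the factor 2.\<close>

lemma sum_UN_approx:
  fixes f :: "'a \<Rightarrow> real"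
  assumes T: "finite T" and X: "\<And>t. t \<in> T \<Longrightarrow> finite (X t)"
    and Y: "\<And>t. t \<in> T \<Longrightarrow> Y t \<subseteq> X t"
    and overlap: "\<And>s t. s \<in> T \<Longrightarrow> t \<in> T \<Longrightarrow> s \<noteq> t \<Longrightarrow> X s \<inter> X t \<subseteq> Y s \<union> Y t"
    and f: "\<And>a. a \<in> (\<Union>t\<in>T. X t) \<Longrightarrow> \<bar>f a\<bar> \<le> B" and "0 \<le> B"
  shows "\<bar>(\<Sum>a\<in>(\<Union>t\<in>T. X t). f a) - (\<Sum>t\<in>T. \<Sum>a\<in>X t. f a)\<bar> \<le> 2 * B * (\<Sum>t\<in>T. real (card (Y t)))"
proof -
  define Z where "Z t = X t - Y t" for t
  \<comment> \<open>The points that belong to no \<open>Z t\<close>; each lies in some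
    \<open>Y t\<close>, which bounds their number.\<close>
  define rest where "rest = (\<Union>t\<in>T. X t) - (\<Union>t\<in>T. Z t)"
  have fin: "finite (\<Union>t\<in>T. X t)"
    using T X by blast
  have "(\<Sum>a\<in>(\<Union>t\<in>T. X t). f a) = (\<Sum>a\<in>rest. f a) + (\<Sum>a\<in>(\<Union>t\<in>T. Z t). f a)"
    unfolding rest_def by (intro sum.subset_diff fin) (auto simp: Z_def)
  also have "(\<Sum>a\<in>(\<Union>t\<in>T. Z t). f a) = (\<Sum>t\<in>T. \<Sum>a\<in>Z t. f a)"
    using T X overlap by (intro sum.UNION_disjoint) (auto simp: Z_def)
  finally have 1: "(\<Sum>a\<in>(\<Union>t\<in>T. X t). f a) = (\<Sum>a\<in>rest. f a) + (\<Sum>t\<in>T. \<Sum>a\<in>Z t. f a)" .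
  have 2: "(\<Sum>t\<in>T. \<Sum>a\<in>X t. f a) = (\<Sum>t\<in>T. \<Sum>a\<in>Z t. f a) + (\<Sum>t\<in>T. \<Sum>a\<in>Y t. f a)"
    unfolding sum.distrib[symmetric] Z_def using X Y by (intro sum.cong sum.subset_diff) auto
  have 3: "\<bar>\<Sum>a\<in>A. f a\<bar> \<le> B * real (card A)" if "A \<subseteq> (\<Union>t\<in>T. X t)" for A
  proof -
    have "\<bar>\<Sum>a\<in>A. f a\<bar> \<le> (\<Sum>a\<in>A. B)"
      using f that by (intro order_trans[OF sum_abs] sum_mono) blast
    then show ?thesis by (simp add: mult.commute)
  qed
  have "\<bar>\<Sum>a\<in>rest. f a\<bar> \<le> B * real (card rest)"
    by (rule 3) (auto simp: rest_def)
  also have "\<dots> \<le> B * (\<Sum>t\<in>T. real (card (Y t)))"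
  proof (intro mult_left_mono \<open>0 \<le> B\<close>)
    have "card rest \<le> card (\<Union>t\<in>T. Y t)"
      using fin Y by (intro card_mono) (auto simp: rest_def Z_def intro: finite_subset[of _ "\<Union>t\<in>T. X t"])
    also have "\<dots> \<le> (\<Sum>t\<in>T. card (Y t))"
      by (rule card_UN_le[OF T])
    finally show "real (card rest) \<le> (\<Sum>t\<in>T. real (card (Y t)))"
      by (simp flip: of_nat_sum)
  qed
  finally have 4: "\<bar>\<Sum>a\<in>rest. f a\<bar> \<le> B * (\<Sum>t\<in>T. real (card (Y t)))" .
  have 5: "\<bar>\<Sum>t\<in>T. \<Sum>a\<in>Y t. f a\<bar> \<le> B * (\<Sum>t\<in>T. real (card (Y t)))"
    unfolding sum_distrib_left using Y by (intro order_trans[OF sum_abs] sum_mono 3) blast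
  show ?thesis
    using 1 2 4 5 by linarith
qed

text \<open>Here \<open>v\<close> is any choice of marked points. It is instantiated with the
  polygon vertices and with the singletons of punctures.\<close>

locale marked_substitution = tiling_substitution p lam \<omega>
  for p :: "'n::finite \<Rightarrow> (real^2) set" and lam \<omega> +
  fixes v :: "'n \<Rightarrow> (real^2) set"
  assumes finite_v: "finite (v i)" and nonempty_v: "v i \<noteq> {}" and v_subset: "v i \<subseteq> p i"
begin

section \<open>Counting marked points: order of growth and scarcity on frontiers\<close>

definition V :: "nat \<Rightarrow> 'n \<Rightarrow> (real^2) set" where
  "V k j = (\<Union>t\<in>R k j. tile_vertices v t)"

lemma finite_vertices: "finite (tile_vertices v t)"
  by (simp add: tile_vertices_def finite_v)

lemma vertices_subset: "tile_vertices v t \<subseteq> tile_region p t"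
  unfolding tile_vertices_def tile_region_def by (intro image_mono v_subset)

lemma vertices_subset_p: "t \<in> R k j \<Longrightarrow> tile_vertices v t \<subseteq> p j"
  using vertices_subset region_subset by blast

lemma finite_V: "finite (V k j)"
  by (simp add: V_def finite_R finite_vertices)

lemma V_subset: "V k j \<subseteq> p j"
  unfolding V_def using vertices_subset_p by blast

lemma V_add: "V (n + k) j = (\<Union>t\<in>R n j. snd t ` V k (fst t))"
  unfolding V_def rescaled_patch_add UN_UN_flatten by (simp add: image_UN tile_vertices_act)

definition nu :: nat where "nu = (\<Sum>i\<in>UNIV. card (v i))"

lemma card_vertices_le: "card (tile_vertices v t) \<le> nu"
proof -
  have "card (tile_vertices v t) \<le> card (v (fst t))"
    unfolding tile_vertices_def by (rule card_image_le[OF finite_v])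
  also have "\<dots> \<le> nu"
    unfolding nu_def by (intro member_le_sum) auto
  finally show ?thesis .
qed

lemma card_V_le: "card (V k j) \<le> (\<Sum>t\<in>R k j. card (tile_vertices v t))"
  unfolding V_def by (rule card_UN_le[OF finite_R])

definition a0 :: real where "a0 = Min (range area)"

lemma a0_pos: "0 < a0" and a0_le: "a0 \<le> area i"
  using area_pos by (auto simp: a0_def)

lemma area_card_le:
  assumes "T \<subseteq> R k j"
  shows "a0 * ((\<mu> ^ k)\<^sup>2 * card T) \<le> (\<Sum>t\<in>T. (\<mu> ^ k)\<^sup>2 * area (fst t))"
proof -
  have "(\<Sum>t\<in>T. (\<mu> ^ k)\<^sup>2 * a0) \<le> (\<Sum>t\<in>T. (\<mu> ^ k)\<^sup>2 * area (fst t))"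
    by (intro sum_mono mult_left_mono a0_le) auto
  then show ?thesis by (simp add: mult_ac)
qed

text \<open>Each tile occupies area at least \<open>a0 * (\<mu> ^ k)\<^sup>2\<close> and carries at
  most \<open>nu\<close> points. The total area replaces \<open>area j\<close> so that one constant
  serves all types.\<close>

lemma card_vertices_upper:
  "(\<mu> ^ k)\<^sup>2 * real (\<Sum>t\<in>R k j. card (tile_vertices v t)) \<le> nu * (\<Sum>i\<in>UNIV. area i) / a0"
proof -
  have "(\<Sum>t\<in>R k j. card (tile_vertices v t)) \<le> (\<Sum>t\<in>R k j. nu)"
    by (intro sum_mono card_vertices_le)
  then have "real (\<Sum>t\<in>R k j. card (tile_vertices v t)) \<le> real (card (R k j) * nu)"
    by (simp only: of_nat_le_iff sum_constant of_nat_id)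
  then have "(\<mu> ^ k)\<^sup>2 * real (\<Sum>t\<in>R k j. card (tile_vertices v t)) \<le> (\<mu> ^ k)\<^sup>2 * (real (card (R k j)) * nu)"
    by (intro mult_left_mono) simp_all
  also have "\<dots> = nu * (a0 * ((\<mu> ^ k)\<^sup>2 * card (R k j))) / a0"
    using a0_pos by simp
  also have "\<dots> \<le> nu * (\<Sum>i\<in>UNIV. area i) / a0"
  proof -
    have "a0 * ((\<mu> ^ k)\<^sup>2 * card (R k j)) \<le> area j"
      using area_card_le[of "R k j" k j] sum_area_R[of k j] by simp
    also have "\<dots> \<le> (\<Sum>i\<in>UNIV. area i)"
      by (intro member_le_sum) auto
    finally show ?thesis
      using a0_pos by (intro divide_right_mono mult_left_mono) auto
  qed
  finally show ?thesis .
qed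

text \<open>Every tile has a vertex, so the discs around the vertices whose radius bounds the diameter of
  the tiles cover the prototile; comparing areas bounds the number of distinct vertices.\<close>

lemma card_V_lower: "a0 / (pi * D\<^sup>2) \<le> (\<mu> ^ k)\<^sup>2 * card (V k j)"
proof -
  define r where "r = \<mu> ^ k * D"
  have r: "0 < r"
    using \<mu>_pos D_pos by (simp add: r_def)
  have "p j \<subseteq> (\<Union>b\<in>V k j. cball b r)"
  proof
    fix a assume "a \<in> p j"
    then obtain t where t: "t \<in> R k j" "a \<in> tile_region p t"
      using Union_R[of k j] by blast
    obtain b where b: "b \<in> tile_vertices v t"
      using nonempty_v[of "fst t"] by (auto simp: tile_vertices_def)
    then have "dist b a \<le> r"
      unfolding r_def using t vertices_subset by (intro dist_region_le[OF t(1)]) blast+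
    then show "a \<in> (\<Union>b\<in>V k j. cball b r)"
      unfolding V_def using t b by auto
  qed
  then have "area j \<le> measure lebesgue (\<Union>b\<in>V k j. cball b r)"
    by (intro measure_mono_fmeasurable fmeasurable.finite_UN finite_V lmeasurable_cball)
       (auto simp: compact_p fmeasurableD lmeasurable_compact)
  also have "\<dots> \<le> (\<Sum>b\<in>V k j. measure lebesgue (cball b r))"
    by (intro measure_UNION_le finite_V) auto
  also have "\<dots> = card (V k j) * (pi * r\<^sup>2)"
    using r by (simp add: measure_completion content_cball unit_ball_vol_2)
  finally have "a0 \<le> ((\<mu> ^ k)\<^sup>2 * card (V k j)) * (pi * D\<^sup>2)"
    using a0_le[of j] by (simp add: r_def power_mult_distrib mult_ac)
  then show ?thesis
    using D_pos by (simp add: pos_divide_le_eq)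
qed

text \<open>Tiles touching the frontier lie within distance \<open>\<mu> ^ k * D\<close> of it.
  Small neighbourhoods of this compact null set have small area, and the area bounds the number of
  such tiles.\<close>

lemma card_V_frontier_tendsto:
  "(\<lambda>k. (\<mu> ^ k)\<^sup>2 * card (V k i \<inter> frontier (p i))) \<longlonglongrightarrow> 0"
proof (rule LIMSEQ_I)
  fix \<epsilon> :: real assume "0 < \<epsilon>"
  define \<epsilon>' where "\<epsilon>' = \<epsilon> * a0 / (nu + 1)"
  have "0 < \<epsilon>'"
    using \<open>0 < \<epsilon>\<close> a0_pos by (simp add: \<epsilon>'_def)
  \<comment> \<open>The semicontinuity of measure used next is applied to the set
    \<open>frontier (p i)\<close> itself, whose own frontier must be null.\<close>
  have "negligible (frontier (frontier (p i)))"
    using negligible_frontier_p frontier_subset_closed[OF frontier_closed] negligible_subset by blast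
  moreover have "bounded (frontier (p i))"
    by (simp add: compact_imp_bounded compact_frontier compact_p)
  moreover have "measure lebesgue (frontier (p i)) = 0"
    by (rule negligible_imp_measure0[OF negligible_frontier_p])
  ultimately obtain d where d: "0 < d"
    "\<And>T. T \<in> lmeasurable \<Longrightarrow> (\<And>y. y \<in> T \<Longrightarrow> \<exists>a. a \<in> frontier (p i) \<and> dist a y < d) \<Longrightarrow> measure lebesgue T < \<epsilon>'"
    using measure_semicontinuous_with_hausdist_explicit[of "frontier (p i)" \<epsilon>'] \<open>0 < \<epsilon>'\<close> by (metis add_0)
  obtain N where N: "\<mu> ^ k * D < d" if "k \<ge> N" for k
    using LIMSEQ_D[OF power_mult_D_tendsto d(1)] by (metis abs_less_iff diff_zero real_norm_def)
  have "norm ((\<mu> ^ k)\<^sup>2 * card (V k i \<inter> frontier (p i)) - 0) < \<epsilon>" if "k \<ge> N" for k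
  proof -
    define T where "T = {t \<in> R k i. tile_region p t \<inter> frontier (p i) \<noteq> {}}"
    have T: "T \<subseteq> R k i" "finite T"
      by (auto simp: T_def finite_R)
    have lm: "tile_region p t \<in> lmeasurable" if "t \<in> T" for t
      using that T by (intro lmeasurable_compact compact_region) blast
    have "measure lebesgue (\<Union>t\<in>T. tile_region p t) < \<epsilon>'"
    proof (rule d(2))
      show "(\<Union>t\<in>T. tile_region p t) \<in> lmeasurable"
        using lm T(2) by (intro fmeasurable.finite_UN) auto
      fix y assume "y \<in> (\<Union>t\<in>T. tile_region p t)"
      then obtain t a where t: "t \<in> R k i" "y \<in> tile_region p t" "a \<in> tile_region p t" "a \<in> frontier (p i)"
        by (auto simp: T_def)
      then have "dist a y < d"
        using dist_region_le[OF t(1,3,2)] N[OF that] by simp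
      then show "\<exists>a. a \<in> frontier (p i) \<and> dist a y < d"
        using t by blast
    qed
    also have "measure lebesgue (\<Union>t\<in>T. tile_region p t) = (\<Sum>t\<in>T. measure lebesgue (tile_region p t))"
      by (intro measure_negligible_finite_Union_image T lm pairwise_subset[OF negligible_region_Int T(1)])
    also have "\<dots> = (\<Sum>t\<in>T. (\<mu> ^ k)\<^sup>2 * area (fst t))"
      using T by (intro sum.cong measure_region) auto
    finally have card_T: "a0 * ((\<mu> ^ k)\<^sup>2 * card T) < \<epsilon>'"
      using area_card_le[OF T(1)] by linarith
    have "V k i \<inter> frontier (p i) \<subseteq> (\<Union>t\<in>T. tile_vertices v t)"
      unfolding V_def T_def using vertices_subset by blast
    then have "card (V k i \<inter> frontier (p i)) \<le> card (\<Union>t\<in>T. tile_vertices v t)"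
      by (intro card_mono finite_UN_I T finite_vertices)
    also have "\<dots> \<le> (\<Sum>t\<in>T. card (tile_vertices v t))"
      by (rule card_UN_le[OF T(2)])
    also have "\<dots> \<le> (\<Sum>t\<in>T. nu)"
      by (intro sum_mono card_vertices_le)
    finally have "real (card (V k i \<inter> frontier (p i))) \<le> real (card T * nu)"
      by (simp only: of_nat_le_iff sum_constant of_nat_id)
    then have "(\<mu> ^ k)\<^sup>2 * card (V k i \<inter> frontier (p i)) \<le> (\<mu> ^ k)\<^sup>2 * (real (card T) * (nu + 1))"
      by (intro mult_left_mono) (auto simp: algebra_simps)
    also have "\<dots> = (a0 * ((\<mu> ^ k)\<^sup>2 * card T)) * ((nu + 1) / a0)"
      using a0_pos by simp
    also have "\<dots> < \<epsilon>' * ((nu + 1) / a0)"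
      using card_T a0_pos by (intro mult_strict_right_mono) auto
    also have "\<dots> = \<epsilon>"
      using a0_pos by (simp add: \<epsilon>'_def)
    finally show ?thesis by simp
  qed
  then show "\<exists>no. \<forall>k\<ge>no. norm ((\<mu> ^ k)\<^sup>2 * card (V k i \<inter> frontier (p i)) - 0) < \<epsilon>"
    by blast
qed

text \<open>Distinct tiles of level \<open>n\<close> meet only along their frontiers, so repeated
  points are images of frontier points of prototiles and \<open>sum_UN_approx\<close>
  applies.\<close>

lemma sum_V_add:
  assumes f: "\<And>a. a \<in> p j \<Longrightarrow> \<bar>f a\<bar> \<le> B"
  shows "\<bar>(\<Sum>a\<in>V (n + k) j. f a) - (\<Sum>t\<in>R n j. \<Sum>a\<in>V k (fst t). (f \<circ> snd t) a)\<bar>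
    \<le> 2 * B * (\<Sum>t\<in>R n j. real (card (V k (fst t) \<inter> frontier (p (fst t)))))"
proof -
  have inj: "inj (snd t)" if "t \<in> R n j" for t
    by (rule similarity_inj[OF similarity_R[OF that]])
  define Y where "Y t = snd t ` (V k (fst t) \<inter> frontier (p (fst t)))" for t :: "'n tile"
  have Y: "Y t = snd t ` V k (fst t) \<inter> frontier (tile_region p t)" if "t \<in> R n j" for t
    unfolding Y_def frontier_region[OF that] using inj[OF that] by (rule image_Int)
  have "interior (p j) \<subseteq> p j" "interior (p j) \<noteq> {}"
    by (auto simp: interior_p interior_subset)
  then have B: "0 \<le> B"
    using f by (metis abs_ge_zero all_not_in_conv order_trans subsetD)
  have sub: "snd t ` V k (fst t) \<subseteq> tile_region p t" for t
    unfolding tile_region_def by (intro image_mono V_subset)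
  have "\<bar>(\<Sum>a\<in>(\<Union>t\<in>R n j. snd t ` V k (fst t)). f a) - (\<Sum>t\<in>R n j. \<Sum>a\<in>snd t ` V k (fst t). f a)\<bar>
      \<le> 2 * B * (\<Sum>t\<in>R n j. real (card (Y t)))"
  proof (rule sum_UN_approx[OF finite_R _ _ _ _ B])
    fix s t assume st: "s \<in> R n j" "t \<in> R n j" "s \<noteq> t"
    then show "snd s ` V k (fst s) \<inter> snd t ` V k (fst t) \<subseteq> Y s \<union> Y t"
      using region_Int_subset[OF st] sub[of s] sub[of t] unfolding Y[OF st(1)] Y[OF st(2)] by blast
  next
    fix a assume "a \<in> (\<Union>t\<in>R n j. snd t ` V k (fst t))"
    then show "\<bar>f a\<bar> \<le> B"
      using f sub region_subset by blast
  qed (auto simp: Y_def finite_V)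
  moreover have "(\<Sum>a\<in>snd t ` V k (fst t). f a) = (\<Sum>a\<in>V k (fst t). (f \<circ> snd t) a)" if "t \<in> R n j" for t
    using inj[OF that] by (simp add: sum.reindex inj_on_subset)
  moreover have "card (Y t) = card (V k (fst t) \<inter> frontier (p (fst t)))" if "t \<in> R n j" for t
    unfolding Y_def by (rule card_image[OF inj_on_subset[OF inj[OF that] subset_UNIV]])
  ultimately show ?thesis
    by (simp add: V_add cong: sum.cong)
qed

lemma sum_vertices_add:
  "(\<Sum>u\<in>R (n + k) j. \<Sum>a\<in>tile_vertices v u. f a)
     = (\<Sum>t\<in>R n j. \<Sum>u\<in>R k (fst t). \<Sum>a\<in>tile_vertices v u. (f \<circ> snd t) a)"
proof -
  have "(\<Sum>a\<in>tile_vertices v (act (snd t) u). f a) = (\<Sum>a\<in>tile_vertices v u. (f \<circ> snd t) a)"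
    if "t \<in> R n j" for t u
    unfolding tile_vertices_act
    by (rule sum.reindex[OF inj_on_subset[OF similarity_inj[OF similarity_R[OF that]] subset_UNIV]])
  then show ?thesis
    by (simp add: sum_R_add cong: sum.cong)
qed

text \<open>When points are counted once per tile, the sum is exactly additive under subdivision, so
  the defect in \<open>equidistribution\<close> is identically zero.\<close>

lemma vertex_multi_limit:
  assumes prim: "primitive_substitution lam \<omega>" and f: "\<And>j. continuous_on (p j) f"
    and disj: "disjoint_family p"
  shows "(\<lambda>k. (\<Sum>t\<in>tiles lam \<omega> k. \<Sum>a\<in>tile_vertices v t. f a)
              / real (\<Sum>t\<in>tiles lam \<omega> k. card (tile_vertices v t)))
           \<longlonglongrightarrow> (\<Sum>j\<in>UNIV. integral (p j) f) / (\<Sum>j\<in>UNIV. area j)"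
proof -
  define \<Phi> where "\<Phi> k j f = (\<Sum>t\<in>R k j. \<Sum>a\<in>tile_vertices v t. f a)" for k j and f :: "real^2 \<Rightarrow> real"
  have \<Phi>1: "\<Phi> k j (\<lambda>_. 1) = real (\<Sum>t\<in>R k j. card (tile_vertices v t))" for k j
    by (simp add: \<Phi>_def)
  have "(\<lambda>k. (\<Sum>j\<in>UNIV. \<Phi> k j f) / (\<Sum>j\<in>UNIV. \<Phi> k j (\<lambda>_. 1)))
           \<longlonglongrightarrow> (\<Sum>j\<in>UNIV. integral (p j) f) / (\<Sum>j\<in>UNIV. area j)"
  proof (rule equidistribution[OF prim _ _ _ _ _ f])
    fix k i f and c \<epsilon> :: real assume *: "\<And>a. a \<in> p i \<Longrightarrow> \<bar>f a - c\<bar> \<le> \<epsilon>"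
    \<comment> \<open>Summing over pairs of a tile and a point makes the iterated sum a single one,
      to which \<open>sum_local\<close> applies.\<close>
    have "\<Phi> k i g = (\<Sum>q\<in>(SIGMA t:R k i. tile_vertices v t). g (snd q))" for g
      unfolding \<Phi>_def by (subst sum.Sigma) (auto simp: finite_R finite_vertices case_prod_unfold)
    moreover have "\<bar>f (snd q) - c\<bar> \<le> \<epsilon>" if "q \<in> (SIGMA t:R k i. tile_vertices v t)" for q
      using that vertices_subset_p[of "fst q" k i] by (intro *) auto
    ultimately show "\<bar>\<Phi> k i f - c * \<Phi> k i (\<lambda>_. 1)\<bar> \<le> \<epsilon> * \<Phi> k i (\<lambda>_. 1)"
      using sum_local[of "SIGMA t:R k i. tile_vertices v t" "\<lambda>q. f (snd q)"] by simp
  next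
    show "(\<lambda>k. (\<mu> ^ k)\<^sup>2 * (\<Phi> (n + k) j f - (\<Sum>t\<in>R n j. \<Phi> k (fst t) (f \<circ> snd t)))) \<longlonglongrightarrow> 0" for n j f
      unfolding \<Phi>_def sum_vertices_add by simp
    show "0 < a0 / (pi * D\<^sup>2)"
      using a0_pos D_pos by simp
    show "a0 / (pi * D\<^sup>2) \<le> (\<mu> ^ k)\<^sup>2 * \<Phi> k i (\<lambda>_. 1)" for k i
      using card_V_le[of k i] unfolding \<Phi>1
      by (intro order_trans[OF card_V_lower[of k i]] mult_left_mono) (auto simp flip: of_nat_sum)
    show "(\<mu> ^ k)\<^sup>2 * \<Phi> k i (\<lambda>_. 1) \<le> nu * (\<Sum>i\<in>UNIV. area i) / a0" for k i
      unfolding \<Phi>1 by (rule card_vertices_upper)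
  qed
  moreover have "(\<Sum>t\<in>tiles lam \<omega> k. g t) = (\<Sum>j\<in>UNIV. \<Sum>t\<in>R k j. g t)" for k and g :: "'n tile \<Rightarrow> real"
    unfolding tiles_eq
  proof (intro sum.UNION_disjoint ballI impI)
    fix i j :: 'n assume "i \<noteq> j"
    have "p i \<inter> p j = {}"
      using disj \<open>i \<noteq> j\<close> by (auto simp: disjoint_family_on_def)
    moreover have "tile_vertices v t \<subseteq> p i \<inter> p j" if "t \<in> R k i" "t \<in> R k j" for t
      using that vertices_subset_p by blast
    ultimately show "R k i \<inter> R k j = {}"
      using nonempty_v by (fastforce simp: tile_vertices_def)
  qed (auto simp: finite_R)
  ultimately show ?thesis
    by (simp add: \<Phi>_def)
qed

text \<open>Without multiplicity, additivity fails only on frontiers of tiles;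
  \<open>sum_V_add\<close> and \<open>card_V_frontier_tendsto\<close> make this defect
  \<open>o(1)\<close> after scaling.\<close>

lemma vertex_limit:
  assumes prim: "primitive_substitution lam \<omega>" and f: "\<And>j. continuous_on (p j) f"
    and disj: "disjoint_family p"
  shows "(\<lambda>k. (\<Sum>a\<in>(\<Union>t\<in>tiles lam \<omega> k. tile_vertices v t). f a)
              / real (card (\<Union>t\<in>tiles lam \<omega> k. tile_vertices v t)))
           \<longlonglongrightarrow> (\<Sum>j\<in>UNIV. integral (p j) f) / (\<Sum>j\<in>UNIV. area j)"
proof -
  define \<Phi> where "\<Phi> k j f = (\<Sum>a\<in>V k j. f a)" for k j and f :: "real^2 \<Rightarrow> real"
  have \<Phi>1: "\<Phi> k j (\<lambda>_. 1) = real (card (V k j))" for k j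
    by (simp add: \<Phi>_def)
  have "(\<lambda>k. (\<Sum>j\<in>UNIV. \<Phi> k j f) / (\<Sum>j\<in>UNIV. \<Phi> k j (\<lambda>_. 1)))
           \<longlonglongrightarrow> (\<Sum>j\<in>UNIV. integral (p j) f) / (\<Sum>j\<in>UNIV. area j)"
  proof (rule equidistribution[OF prim _ _ _ _ _ f])
    fix k i f and c \<epsilon> :: real assume "\<And>a. a \<in> p i \<Longrightarrow> \<bar>f a - c\<bar> \<le> \<epsilon>"
    then show "\<bar>\<Phi> k i f - c * \<Phi> k i (\<lambda>_. 1)\<bar> \<le> \<epsilon> * \<Phi> k i (\<lambda>_. 1)"
      unfolding \<Phi>_def using V_subset by (intro sum_local) blast
  next
    fix n j and f :: "real^2 \<Rightarrow> real" and B assume B: "\<And>a. a \<in> p j \<Longrightarrow> \<bar>f a\<bar> \<le> B"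
    show "(\<lambda>k. (\<mu> ^ k)\<^sup>2 * (\<Phi> (n + k) j f - (\<Sum>t\<in>R n j. \<Phi> k (fst t) (f \<circ> snd t)))) \<longlonglongrightarrow> 0"
    proof (rule Lim_null_comparison, intro always_eventually allI)
      fix k
      have "(\<mu> ^ k)\<^sup>2 * \<bar>\<Phi> (n + k) j f - (\<Sum>t\<in>R n j. \<Phi> k (fst t) (f \<circ> snd t))\<bar>
          \<le> (\<mu> ^ k)\<^sup>2 * (2 * B * (\<Sum>t\<in>R n j. real (card (V k (fst t) \<inter> frontier (p (fst t))))))"
        unfolding \<Phi>_def by (intro mult_left_mono sum_V_add B) auto
      then show "norm ((\<mu> ^ k)\<^sup>2 * (\<Phi> (n + k) j f - (\<Sum>t\<in>R n j. \<Phi> k (fst t) (f \<circ> snd t))))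
          \<le> 2 * B * (\<Sum>t\<in>R n j. (\<mu> ^ k)\<^sup>2 * card (V k (fst t) \<inter> frontier (p (fst t))))"
        by (simp add: abs_mult mult_ac flip: sum_distrib_left)
    next
      have "(\<lambda>k. \<Sum>t\<in>R n j. (\<mu> ^ k)\<^sup>2 * card (V k (fst t) \<inter> frontier (p (fst t)))) \<longlonglongrightarrow> (\<Sum>t\<in>R n j. 0)"
        by (intro tendsto_sum card_V_frontier_tendsto)
      then show "(\<lambda>k. 2 * B * (\<Sum>t\<in>R n j. (\<mu> ^ k)\<^sup>2 * card (V k (fst t) \<inter> frontier (p (fst t))))) \<longlonglongrightarrow> 0"
        by (intro tendsto_mult_right_zero) simp
    qed
  next
    show "0 < a0 / (pi * D\<^sup>2)"
      using a0_pos D_pos by simp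
    show "a0 / (pi * D\<^sup>2) \<le> (\<mu> ^ k)\<^sup>2 * \<Phi> k i (\<lambda>_. 1)" for k i
      unfolding \<Phi>1 by (rule card_V_lower)
    show "(\<mu> ^ k)\<^sup>2 * \<Phi> k i (\<lambda>_. 1) \<le> nu * (\<Sum>i\<in>UNIV. area i) / a0" for k i
      unfolding \<Phi>1 using card_V_le[of k i]
      by (intro order_trans[OF mult_left_mono card_vertices_upper[of k i]]) (auto simp flip: of_nat_sum)
  qed
  moreover have "(\<Sum>a\<in>(\<Union>t\<in>tiles lam \<omega> k. tile_vertices v t). g a) = (\<Sum>j\<in>UNIV. \<Sum>a\<in>V k j. g a)"
    for k and g :: "real^2 \<Rightarrow> real"
  proof -
    \<comment> \<open>Disjoint prototiles share no marked points, so coincidences occur only within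
      one prototile and the count splits over \<open>j\<close>.\<close>
    have "(\<Union>t\<in>tiles lam \<omega> k. tile_vertices v t) = (\<Union>j. V k j)"
      by (auto simp: tiles_eq V_def)
    moreover have "V k i \<inter> V k j = {}" if "i \<noteq> j" for i j
      using disj that V_subset[of k i] V_subset[of k j] by (fastforce simp: disjoint_family_on_def)
    ultimately show ?thesis
      by (simp add: sum.UNION_disjoint finite_V)
  qed
  from this[where g = f] this[where g = "\<lambda>_. 1"] have
    "(\<Sum>a\<in>(\<Union>t\<in>tiles lam \<omega> k. tile_vertices v t). f a) = (\<Sum>j\<in>UNIV. \<Phi> k j f)"
    "real (card (\<Union>t\<in>tiles lam \<omega> k. tile_vertices v t)) = (\<Sum>j\<in>UNIV. \<Phi> k j (\<lambda>_. 1))" for k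
    by (simp_all add: \<Phi>_def)
  ultimately show ?thesis
    by simp
qed

end

section \<open>Polygons and empirical measures\<close>

lemma pathstart_polygonal_path: "pathstart (polygonal_path (a # vs)) = a"
  by (cases "a # vs" rule: polygonal_path.cases) auto

lemma negligible_closed_segment:
  fixes a b :: "'a::euclidean_space"
  assumes "2 \<le> DIM('a)" shows "negligible (closed_segment a b)"
  using assms by (simp add: negligible_convex_interior interior_closed_segment_ge2)

text \<open>The curve is covered by finitely many segments, each a null set in the plane.\<close>

lemma negligible_path_image_polygonal_path:
  "negligible (path_image (polygonal_path vs :: real \<Rightarrow> real^2))"
proof (induction vs rule: polygonal_path.induct)
  case (4 a b c vs)
  have "negligible (closed_segment a b \<union> path_image (polygonal_path (b # c # vs)))"
    using 4 by (simp add: negligible_Un negligible_closed_segment)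
  then show ?case
    unfolding polygonal_path.simps
    by (rule negligible_subset) (use path_image_join_subset path_image_linepath in metis)
qed (simp_all add: negligible_closed_segment)

lemma set_subset_path_image_polygonal_path:
  "set vs \<subseteq> path_image (polygonal_path vs)" if "vs \<noteq> []"
  using that
proof (induction vs rule: polygonal_path.induct)
  case (4 a b c vs)
  then show ?case
    by (auto simp: path_image_join pathstart_polygonal_path)
qed auto

text \<open>Supplies the locale assumptions. Vertices lie on the bounding curve, hence in the closed
  set \<open>P\<close>.\<close>

lemma polygon_with_verticesD:
  assumes "polygon_with_vertices P V"
  shows "compact P" "interior P \<noteq> {}" "negligible (frontier P)" "finite V" "V \<noteq> {}" "V \<subseteq> P"
proof -
  obtain vs where vs: "3 \<le> length vs" "set vs = V" "frontier P = path_image (polygonal_path (vs @ [hd vs]))"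
    and P: "compact P" "interior P \<noteq> {}"
    using assms by (auto simp: polygon_with_vertices_def)
  show "compact P" "interior P \<noteq> {}" by fact+
  show "negligible (frontier P)"
    by (simp add: vs(3) negligible_path_image_polygonal_path)
  show "finite V" "V \<noteq> {}"
    using vs by auto
  have "V \<subseteq> frontier P"
    using set_subset_path_image_polygonal_path[of "vs @ [hd vs]"] vs by auto
  then show "V \<subseteq> P"
    using P(1) compact_imp_closed frontier_subset_closed by blast
qed

text \<open>The measure is the image under \<open>y\<close> of the uniform measure on
  \<open>I\<close>, so its integral is an average. Indexing by \<open>I\<close> instead of by points
  allows repeated points.\<close>

lemma integral_normalized_sum_of_returns:
  fixes y :: "'i \<Rightarrow> 'a::topological_space" and f :: "'a \<Rightarrow> real"
  assumes I: "finite I" "I \<noteq> {}" and y: "\<And>i. i \<in> I \<Longrightarrow> y i \<in> X" and f: "continuous_on X f"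
  shows "integral\<^sup>L (measure_of X (sets (restrict_space borel X))
      (\<lambda>B. (\<Sum>i\<in>I. emeasure (return (restrict_space borel X) (y i)) B) / of_nat (card I))) f
    = (\<Sum>i\<in>I. f (y i)) / real (card I)"
proof -
  let ?M = "restrict_space borel X"
  define N where "N = distr (uniform_count_measure I) ?M y"
  have space_M: "space ?M = X"
    by (simp add: space_restrict_space)
  have meas: "y \<in> measurable (uniform_count_measure I) ?M"
    using y by (auto simp: measurable_def space_M space_uniform_count_measure sets_uniform_count_measure)
  have "(\<Sum>i\<in>I. emeasure (return ?M (y i)) B) / of_nat (card I) = emeasure N B" if B: "B \<in> sets ?M" for B
  proof -
    have "(\<Sum>i\<in>I. emeasure (return ?M (y i)) B) = of_nat (card (y -` B \<inter> I))"
      using B I by (simp add: indicator_def sum.If_cases Int_def vimage_def conj_commute)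
    also have "\<dots> / of_nat (card I) = ennreal (real (card (y -` B \<inter> I)) / real (card I))"
      using I by (simp add: ennreal_of_nat_eq_real_of_nat divide_ennreal card_gt_0_iff)
    also have "\<dots> = emeasure N B"
      using I meas B by (simp add: N_def emeasure_distr space_uniform_count_measure emeasure_uniform_count_measure)
    finally show ?thesis .
  qed
  then have "measure_of X (sets ?M) (\<lambda>B. (\<Sum>i\<in>I. emeasure (return ?M (y i)) B) / of_nat (card I))
      = measure_of X (sets ?M) (emeasure N)"
    using sets.space_closed[of ?M] sets.sigma_sets_eq[of ?M] unfolding space_M
    by (intro measure_of_eq) blast+
  also have "\<dots> = N"
    using measure_of_of_measure[of N] by (simp add: N_def space_M)
  finally have "measure_of X (sets ?M)
      (\<lambda>B. (\<Sum>i\<in>I. emeasure (return ?M (y i)) B) / of_nat (card I)) = N" .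
  then show ?thesis
    using I f
    by (simp add: N_def integral_distr[OF meas] borel_measurable_continuous_on_restrict
        integral_uniform_count_measure)
qed

theorem theorem1p1:
  fixes p v :: "'n::finite \<Rightarrow> (real^2) set"
    and x :: "'n \<Rightarrow> real^2"
    and lam :: real
    and \<omega> :: "'n \<Rightarrow> 'n tile set"
    and X :: "(real^2) set"
  assumes polygons: "\<And>i. polygon_with_vertices (p i) (v i)"
    and punctures: "\<And>i. x i \<in> interior (p i)"
    and disjoint: "disjoint_family p"
    and area: "(\<Sum>i\<in>UNIV. measure lborel (p i)) = 1"
    and subst: "is_substitution p lam \<omega>"
    and primitive: "primitive_substitution lam \<omega>"
    and X: "X = (\<Union>i. p i)"
  shows "weak_star_conv X (\<lambda>k. puncture_measure X x (tiles lam \<omega> k)) (restrict_space lborel X)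
       \<and> weak_star_conv X (\<lambda>k. vertex_multi_measure X v (tiles lam \<omega> k)) (restrict_space lborel X)
       \<and> weak_star_conv X (\<lambda>k. vertex_measure X v (tiles lam \<omega> k)) (restrict_space lborel X)"
proof -
  note poly = polygon_with_verticesD[OF polygons]
  interpret verts: marked_substitution p lam \<omega> v
    by unfold_locales (use poly subst in auto)
  \<comment> \<open>Punctures count as one-point vertex sets, so the result with multiplicity covers
    them: each tile contributes exactly one point.\<close>
  interpret punct: marked_substitution p lam \<omega> "\<lambda>i. {x i}"
    by unfold_locales (use punctures interior_subset in auto)
  let ?T = "tiles lam \<omega>"
  have "compact X"
    unfolding X by (intro compact_UN) (auto simp: poly)
  have finite_T: "finite (?T k)" for k
    by (simp add: tiles_eq verts.finite_R)
  have T_nonempty: "?T k \<noteq> {}" for k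
  proof -
    have "(\<Union>t\<in>rescaled_patch lam \<omega> k undefined. tile_region p t) \<noteq> {}"
      unfolding verts.Union_R using poly(5,6)[of undefined] by blast
    then show ?thesis
      by (auto simp: tiles_eq)
  qed
  have vertices_X: "tile_vertices v t \<subseteq> X" and puncture_X: "tile_puncture x t \<in> X" if T: "t \<in> ?T k" for t k
  proof -
    obtain j where t: "t \<in> rescaled_patch lam \<omega> k j"
      using T by (auto simp: tiles_eq)
    show "tile_vertices v t \<subseteq> X"
      using verts.vertices_subset_p[OF t] unfolding X by blast
    show "tile_puncture x t \<in> X"
      using punct.vertices_subset_p[OF t] unfolding X tile_vertices_def tile_puncture_def by blast
  qed
  have area': "(\<Sum>i\<in>UNIV. measure lebesgue (p i)) = 1"
    using area poly(1) by (simp add: measure_completion compact_imp_closed borel_closed)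
  \<comment> \<open>Total area 1 removes the denominator, and disjointness of the prototiles joins
    the integrals into one over \<open>X\<close>.\<close>
  have rhs: "(\<Sum>j\<in>UNIV. integral (p j) f) / (\<Sum>j\<in>UNIV. measure lebesgue (p j))
      = integral\<^sup>L (restrict_space lborel X) f" if f: "continuous_on X f" for f :: "real^2 \<Rightarrow> real"
  proof -
    have int: "set_integrable lborel S f" if "compact S" "S \<subseteq> X" for S
      using that continuous_on_subset[OF f] by (simp only: set_integrable_def borel_integrable_compact)
    have "integral\<^sup>L (restrict_space lborel X) f = (LINT x:X|lborel. f x)"
      using \<open>compact X\<close>
      by (simp add: integral_restrict_space set_lebesgue_integral_def compact_imp_closed borel_closed)
    also have "\<dots> = integral X f"
      by (intro set_borel_integral_eq_integral int \<open>compact X\<close>) simp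
    also have "\<dots> = (\<Sum>j\<in>UNIV. integral (p j) f)"
      unfolding X
    proof (intro integral_unique has_integral_UN integrable_integral set_borel_integral_eq_integral(1) int poly)
      show "pairwise (\<lambda>i j. negligible (p i \<inter> p j)) UNIV"
        using disjoint by (auto simp: pairwise_def disjoint_family_on_def)
    qed (auto simp: X)
    finally show ?thesis
      by (simp add: area')
  qed
  have on_p: "continuous_on (p j) f" if "continuous_on X f" for j and f :: "real^2 \<Rightarrow> real"
    using continuous_on_subset[OF that] X by blast
  have "weak_star_conv X (\<lambda>k. puncture_measure X x (?T k)) (restrict_space lborel X)"
    unfolding weak_star_conv_def
  proof (intro allI impI)
    fix f :: "real^2 \<Rightarrow> real" assume f: "continuous_on X f"
    have "integral\<^sup>L (puncture_measure X x (?T k)) f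
        = (\<Sum>t\<in>?T k. \<Sum>a\<in>tile_vertices (\<lambda>i. {x i}) t. f a) / real (\<Sum>t\<in>?T k. card (tile_vertices (\<lambda>i. {x i}) t))" for k
      unfolding puncture_measure_def
      by (subst integral_normalized_sum_of_returns[OF finite_T T_nonempty puncture_X f])
         (simp_all add: tile_vertices_def tile_puncture_def)
    then show "(\<lambda>k. integral\<^sup>L (puncture_measure X x (?T k)) f) \<longlonglongrightarrow> integral\<^sup>L (restrict_space lborel X) f"
      using punct.vertex_multi_limit[OF primitive on_p[OF f] disjoint] by (simp add: rhs[OF f])
  qed
  moreover have "weak_star_conv X (\<lambda>k. vertex_multi_measure X v (?T k)) (restrict_space lborel X)"
    unfolding weak_star_conv_def
  proof (intro allI impI)
    fix f :: "real^2 \<Rightarrow> real" assume f: "continuous_on X f"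
    have "integral\<^sup>L (vertex_multi_measure X v (?T k)) f
        = (\<Sum>t\<in>?T k. \<Sum>a\<in>tile_vertices v t. f a) / real (\<Sum>t\<in>?T k. card (tile_vertices v t))" for k
    proof -
      \<comment> \<open>Pairs of a tile and one of its vertices index the point masses with their
        multiplicities.\<close>
      let ?I = "SIGMA t:?T k. tile_vertices v t"
      have S: "(\<Sum>t\<in>?T k. \<Sum>a\<in>tile_vertices v t. g a) = (\<Sum>q\<in>?I. g (snd q))" for g :: "real^2 \<Rightarrow> 'b::comm_monoid_add"
        by (subst sum.Sigma) (auto simp: finite_T verts.finite_vertices case_prod_unfold)
      have c: "(\<Sum>t\<in>?T k. card (tile_vertices v t)) = card ?I"
        by (simp add: finite_T verts.finite_vertices)
      have nonempty: "?I \<noteq> {}"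
        using T_nonempty poly(5) by (auto simp: tile_vertices_def)
      have "finite ?I"
        by (simp add: finite_T verts.finite_vertices)
      then show ?thesis
        unfolding vertex_multi_measure_def S c
      proof (rule integral_normalized_sum_of_returns[OF _ nonempty _ f])
        show "snd q \<in> X" if "q \<in> ?I" for q
          using that vertices_X[of "fst q" k] by auto
      qed
    qed
    then show "(\<lambda>k. integral\<^sup>L (vertex_multi_measure X v (?T k)) f) \<longlonglongrightarrow> integral\<^sup>L (restrict_space lborel X) f"
      using verts.vertex_multi_limit[OF primitive on_p[OF f] disjoint] by (simp add: rhs[OF f])
  qed
  moreover have "weak_star_conv X (\<lambda>k. vertex_measure X v (?T k)) (restrict_space lborel X)"
    unfolding weak_star_conv_def
  proof (intro allI impI)
    fix f :: "real^2 \<Rightarrow> real" assume f: "continuous_on X f"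
    have "integral\<^sup>L (vertex_measure X v (?T k)) f
        = (\<Sum>a\<in>(\<Union>t\<in>?T k. tile_vertices v t). f a) / real (card (\<Union>t\<in>?T k. tile_vertices v t))" for k
      unfolding vertex_measure_def
    proof (rule integral_normalized_sum_of_returns[OF _ _ _ f])
      show "(\<Union>t\<in>?T k. tile_vertices v t) \<noteq> {}"
        using T_nonempty[of k] poly(5) by (auto simp: tile_vertices_def)
      show "finite (\<Union>t\<in>?T k. tile_vertices v t)"
        by (simp add: finite_T verts.finite_vertices)
      show "a \<in> X" if "a \<in> (\<Union>t\<in>?T k. tile_vertices v t)" for a
        using that vertices_X by blast
    qed
    then show "(\<lambda>k. integral\<^sup>L (vertex_measure X v (?T k)) f) \<longlonglongrightarrow> integral\<^sup>L (restrict_space lborel X) f"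
      using verts.vertex_limit[OF primitive on_p[OF f] disjoint] by (simp add: rhs[OF f])
  qed
  ultimately show ?thesis by blast
qed

end
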